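(* Let $n\ge 1$. There exists a $T$-equivariant isomorphism of projective varieties $$\zeta:\mathcal{F}l^a_{n+1}\xrightarrow{\ \simeq\ }X_{\sigma}\subset SL_{2n}/P,$$ where $P=P_{\omega_1+\omega_3+\cdots+\omega_{2n-1}}$ and $\sigma=\sigma_n\in\mathrm{Sym}_{2n}$ is the permutation given by $\sigma_n(2k)=k$ for $1\le k\le n$ and $\sigma_n(2k+1)=n+1+k$ for $0\le k\le n-1$.
   Context: All varieties are over $\mathbb{C}$. Degenerate flag variety. Let $V\simeq\mathbb{C}^{n+1}$ with ordered basis $f_1,\dots,f_{n+1}$ and let $\mathrm{pr}_k:V\to V$, $\mathrm{pr}_k(\sum_i a_if_i)=\sum_{i\neq k}a_if_i$. The complete degenerate flag variety of $SL_{n+1}$ is $$\mathcal{F}l^a_{n+1}=\Big\{(V_1,\dots,V_n)\in\prod_{i=1}^n\mathrm{Gr}_i(V)\ \Big|\ \mathrm{pr}_i(V_i)\subset V_{i+1}\ \forall i=1,\dots,n-1\Big\}.$$ Schubert variety. Let $W\simeq\mathbb{C}^{2n}$ with ordered basis $e_1,\dots,e_{2n}$, $B\subset SL_{2n}$ the upper triangular matrices, $T\subset B$ the diagonal matrices, $\omega_1,\dots,\omega_{2n-1}$ the fundamental weights, and $P_\lambda\supseteq B$ the parabolic subgroup that is the stabilizer of the weight $\lambda$. For $P=P_{\omega_1+\omega_3+\cdots+\omega_{2n-1}}$, the variety $SL_{2n}/P$ is identified with the set of partial flags $W_1\subset W_2\subset\cdots\subset W_n$ in $W$ with $\dim W_i=2i-1$.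 For a permutation $\tau\in\mathrm{Sym}_{2n}$, $X_\tau=\overline{B\tau P/P}$ is the closure of the $B$-orbit of the flag $\langle e_{\tau(1)}\rangle\subset\langle e_{\tau(1)},e_{\tau(2)},e_{\tau(3)}\rangle\subset\cdots\subset\langle e_{\tau(1)},\dots,e_{\tau(2n-1)}\rangle$. Torus actions. $\underline\lambda=\mathrm{diag}(\lambda_1,\dots,\lambda_{2n})\in T$ acts on $W$ by $\underline\lambda e_k=\lambda_ke_k$, hence on $SL_{2n}/P$ (preserving $X_\sigma$). It acts on the $i$-th Grassmannian factor $\mathrm{Gr}_i(V)$ through the linear action on $V$ given by $f_k\mapsto\lambda_kf_k$ if $i\le k\le n+1$ and $f_k\mapsto\lambda_{n+1+k}f_k$ if $1\le k\le i-1$; this gives an action of $T$ on $\prod_i\mathrm{Gr}_i(V)$ that preserves $\mathcal{F}l^a_{n+1}$. *)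

theory Defs
  imports
    Complex_Main
    "HOL-Library.FuncSet"
    "HOL-Library.Function_Algebras"
    "HOL-Combinatorics.Permutations"
    "Jordan_Normal_Form.Determinant"
begin

section \<open>Coordinate spaces and Grassmannians\<close>

text \<open>Coordinates are numbered from 1: a vector of \<open>\<complex>\<^sup>m\<close> is a function \<open>nat \<Rightarrow> complex\<close> vanishing
  outside \<open>{1..m}\<close>.  Matrices come from the matrix library and are numbered from 0.\<close>

type_synonym cvec = "nat \<Rightarrow> complex"

global_interpretation cvec: vector_space "\<lambda>(c::complex) (v::cvec) k. c * v k"
  by unfold_locales (auto simp: fun_eq_iff algebra_simps)

definition coord_space :: "nat \<Rightarrow> cvec set" where
  "coord_space m = {v. \<forall>k. k \<notin> {1..m} \<longrightarrow> v k = 0}"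

definition basis_vec :: "nat \<Rightarrow> cvec" where
  "basis_vec k = (\<lambda>j. if j = k then 1 else 0)"

definition Gr :: "nat \<Rightarrow> nat \<Rightarrow> cvec set set" where
  "Gr k m = {S. cvec.subspace S \<and> S \<subseteq> coord_space m \<and> cvec.dim S = k}"


section \<open>Products of Grassmannians as projective varieties\<close>

text \<open>\<open>\<lparr>factors = r, rk = d, amb = m\<rparr>\<close> stands for the product of the Grassmannians of
  \<open>d i\<close>-dimensional subspaces of \<open>\<complex>\<^sup>m\<close>, for \<open>i = 1, \<dots>, r\<close>.\<close>

record gr_product =
  factors :: nat
  rk :: "nat \<Rightarrow> nat"
  amb :: nat

type_synonym point = "nat \<Rightarrow> cvec set"

definition points :: "gr_product \<Rightarrow> point set" where
  "points G = (\<Pi>\<^sub>E i\<in>{1..factors G}. Gr (rk G i) (amb G))"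

text \<open>The Pluecker embedding.  The homogeneous coordinates are indexed by the subsets \<open>J\<close> of
  \<open>{1..m}\<close> with \<open>k\<close> elements; the coordinate vector attached to a basis of \<open>S\<close> consists of the
  maximal minors of the \<open>m \<times> k\<close> matrix whose columns are the basis vectors.  As the basis
  varies one gets all the representatives of one point of projective space, so the set
  \<open>plucker k m S\<close> is the punctured line representing the image of \<open>S\<close>.\<close>

definition plucker_vec :: "nat \<Rightarrow> nat \<Rightarrow> cvec list \<Rightarrow> nat set \<Rightarrow> complex" where
  "plucker_vec k m vs = (\<lambda>J. if J \<subseteq> {1..m} \<and> card J = k
      then det (mat k k (\<lambda>(a, b). (vs ! b) (sorted_list_of_set J ! a))) else 0)"

definition plucker :: "nat \<Rightarrow> nat \<Rightarrow> cvec set \<Rightarrow> (nat set \<Rightarrow> complex) set" where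
  "plucker k m S = {plucker_vec k m vs | vs.
      length vs = k \<and> distinct vs \<and> cvec.independent (set vs) \<and> cvec.span (set vs) = S}"

text \<open>Systems of homogeneous coordinates, one for each factor; \<open>p i J\<close> is the coordinate \<open>J\<close> in
  the factor \<open>i\<close>.\<close>

type_synonym multicoords = "nat \<Rightarrow> nat set \<Rightarrow> complex"

definition hom_coords :: "gr_product \<Rightarrow> point \<Rightarrow> multicoords set" where
  "hom_coords G x = {p. (\<forall>i\<in>{1..factors G}. p i \<in> plucker (rk G i) (amb G) (x i)) \<and>
                        (\<forall>i. i \<notin> {1..factors G} \<longrightarrow> p i = (\<lambda>_. 0))}"

inductive_set poly_fun :: "(multicoords \<Rightarrow> complex) set" where
  const: "(\<lambda>_. c) \<in> poly_fun"
| coord: "(\<lambda>p. p i J) \<in> poly_fun"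
| add: "F \<in> poly_fun \<Longrightarrow> H \<in> poly_fun \<Longrightarrow> (\<lambda>p. F p + H p) \<in> poly_fun"
| mult: "F \<in> poly_fun \<Longrightarrow> H \<in> poly_fun \<Longrightarrow> (\<lambda>p. F p * H p) \<in> poly_fun"

text \<open>Multihomogeneity of multidegree \<open>D\<close>, expressed by scaling; since \<open>\<complex>\<close> is infinite this is the
  same as homogeneity of the underlying polynomial in each of the \<open>r\<close> groups of variables.\<close>

definition multihom :: "nat \<Rightarrow> (nat \<Rightarrow> nat) \<Rightarrow> (multicoords \<Rightarrow> complex) set" where
  "multihom r D = {F \<in> poly_fun.
      \<forall>c p. F (\<lambda>i J. c i * p i J) = (\<Prod>i\<in>{1..r}. c i ^ D i) * F p}"

definition zariski_closed :: "gr_product \<Rightarrow> point set \<Rightarrow> bool" where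
  "zariski_closed G Z \<longleftrightarrow> (\<exists>\<F> \<subseteq> (\<Union>D. multihom (factors G) D).
      Z = {x \<in> points G. \<forall>F\<in>\<F>. \<forall>p\<in>hom_coords G x. F p = 0})"

text \<open>A map is regular if, locally in the Zariski topology, each of its components
  is given in homogeneous coordinates by multihomogeneous polynomials of the same multidegree.
  That these have no common zero on the neighbourhood is part of the membership in
  \<open>plucker\<close>, as Pluecker vectors are nonzero.\<close>

definition regular_map ::
  "gr_product \<Rightarrow> point set \<Rightarrow> gr_product \<Rightarrow> point set \<Rightarrow> (point \<Rightarrow> point) \<Rightarrow> bool" where
  "regular_map G X H Y \<phi> \<longleftrightarrow> \<phi> \<in> X \<rightarrow> Y \<and>
     (\<forall>x\<in>X. \<exists>Z. zariski_closed G Z \<and> x \<notin> Z \<and>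
        (\<exists>D F. \<forall>j\<in>{1..factors H}.
           (\<forall>J. F j J \<in> multihom (factors G) (D j)) \<and>
           (\<forall>y\<in>X - Z. \<forall>p\<in>hom_coords G y.
              (\<lambda>J. F j J p) \<in> plucker (rk H j) (amb H) (\<phi> y j))))"

definition projective_variety_iso ::
  "gr_product \<Rightarrow> point set \<Rightarrow> gr_product \<Rightarrow> point set \<Rightarrow> (point \<Rightarrow> point) \<Rightarrow> bool" where
  "projective_variety_iso G X H Y \<phi> \<longleftrightarrow>
     zariski_closed G X \<and> zariski_closed H Y \<and> bij_betw \<phi> X Y \<and>
     regular_map G X H Y \<phi> \<and> regular_map H Y G X (inv_into X \<phi>)"


section \<open>The degenerate flag variety\<close>

definition deg_flag_ambient :: "nat \<Rightarrow> gr_product" where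
  "deg_flag_ambient n = \<lparr>factors = n, rk = (\<lambda>i. i), amb = n + 1\<rparr>"

definition pr :: "nat \<Rightarrow> cvec \<Rightarrow> cvec" where
  "pr k v = v(k := 0)"

definition deg_flag :: "nat \<Rightarrow> point set" where
  "deg_flag n = {V \<in> points (deg_flag_ambient n). \<forall>i\<in>{1..<n}. pr i ` V i \<subseteq> V (i + 1)}"


section \<open>Schubert varieties\<close>

text \<open>The quotient \<open>SL/P\<close> of the special linear group of \<open>\<complex>\<^bsup>2n\<^esup>\<close> by the parabolic subgroup of
  \<open>\<omega>\<^sub>1 + \<omega>\<^sub>3 + \<dots>\<close> is identified with the variety \<open>odd_flag n\<close> of partial flags of
  dimensions \<open>1, 3, \<dots>, 2n-1\<close>.\<close>

definition odd_flag_ambient :: "nat \<Rightarrow> gr_product" where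
  "odd_flag_ambient n = \<lparr>factors = n, rk = (\<lambda>i. 2 * i - 1), amb = 2 * n\<rparr>"

definition odd_flag :: "nat \<Rightarrow> point set" where
  "odd_flag n = {W \<in> points (odd_flag_ambient n). \<forall>i\<in>{1..<n}. W i \<subseteq> W (i + 1)}"

definition borel_group :: "nat \<Rightarrow> complex mat set" where
  "borel_group n = {A \<in> carrier_mat (2 * n) (2 * n). upper_triangular A \<and> det A = 1}"

definition torus :: "nat \<Rightarrow> complex mat set" where
  "torus n = {A \<in> borel_group n. diagonal_mat A}"

definition mat_apply :: "complex mat \<Rightarrow> cvec \<Rightarrow> cvec" where
  "mat_apply A v = (\<lambda>i. if i \<in> {1..dim_row A}
      then \<Sum>j\<in>{1..dim_col A}. A $$ (i - 1, j - 1) * v j else 0)"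

definition flag_act :: "nat \<Rightarrow> complex mat \<Rightarrow> point \<Rightarrow> point" where
  "flag_act n A W = (\<lambda>i\<in>{1..n}. mat_apply A ` W i)"

definition coord_flag :: "nat \<Rightarrow> (nat \<Rightarrow> nat) \<Rightarrow> point" where
  "coord_flag n \<tau> = (\<lambda>i\<in>{1..n}. cvec.span ((\<lambda>k. basis_vec (\<tau> k)) ` {1..2 * i - 1}))"

text \<open>The closure is taken in \<open>odd_flag n\<close>, with the topology induced from the product of
  Grassmannians.\<close>

definition schubert :: "nat \<Rightarrow> (nat \<Rightarrow> nat) \<Rightarrow> point set" where
  "schubert n \<tau> = {W \<in> odd_flag n. \<forall>Z. zariski_closed (odd_flag_ambient n) Z \<and>
      (\<lambda>A. flag_act n A (coord_flag n \<tau>)) ` borel_group n \<subseteq> Z \<longrightarrow> W \<in> Z}"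

definition sigma :: "nat \<Rightarrow> nat \<Rightarrow> nat" where
  "sigma n j = (if j \<in> {1..2 * n} then (if even j then j div 2 else n + 1 + j div 2) else j)"

lemma sigma_even: "k \<in> {1..n} \<Longrightarrow> sigma n (2 * k) = k"
  by (simp add: sigma_def)

lemma sigma_odd: "k < n \<Longrightarrow> sigma n (2 * k + 1) = n + 1 + k"
  by (simp add: sigma_def)

lemma sigma_permutes: "sigma n permutes {1..2 * n}"
proof (rule bij_imp_permutes)
  have inj: "inj_on (sigma n) {1..2 * n}"
  proof (rule inj_onI)
    fix a b assume ab: "a \<in> {1..2 * n}" "b \<in> {1..2 * n}" "sigma n a = sigma n b"
    then show "a = b"
      by (cases "even a"; cases "even b") (auto simp: sigma_def elim!: evenE oddE)
  qed
  have "sigma n ` {1..2 * n} \<subseteq> {1..2 * n}"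
    by (auto simp: sigma_def elim!: evenE oddE)
  then show "bij_betw (sigma n) {1..2 * n} {1..2 * n}"
    using inj by (simp add: bij_betw_def endo_inj_surj)
qed (auto simp: sigma_def)


section \<open>The torus action on the degenerate flag variety\<close>

text \<open>The entry \<open>\<lambda>\<^sub>k\<close> of \<open>A = diag(\<lambda>\<^sub>1,\<dots>,\<lambda>\<^bsub>2n\<^esub>)\<close> is \<open>A $$ (k - 1, k - 1)\<close>.\<close>

definition window_act :: "nat \<Rightarrow> complex mat \<Rightarrow> nat \<Rightarrow> cvec \<Rightarrow> cvec" where
  "window_act n A i v = (\<lambda>k.
      if k \<in> {i..n + 1} then A $$ (k - 1, k - 1) * v k
      else if k \<in> {1..i - 1} then A $$ (n + 1 + k - 1, n + 1 + k - 1) * v k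
      else 0)"

definition deg_flag_act :: "nat \<Rightarrow> complex mat \<Rightarrow> point \<Rightarrow> point" where
  "deg_flag_act n A V = (\<lambda>i\<in>{1..n}. window_act n A i ` V i)"

end

theory Submission
  imports Defs
begin

text \<open>The isomorphism \<open>\<zeta>\<close> sends a degenerate flag \<open>(V\<^sub>1, \<dots>, V\<^sub>n)\<close> to the subspaces
  \<open>W\<^sub>i = \<langle>e\<^sub>1, \<dots>, e\<^bsub>i-1\<^esub>\<rangle> \<oplus> \<phi>\<^sub>i(V\<^sub>i)\<close>, where \<open>\<phi>\<^sub>i\<close> identifies \<open>V\<close> with the window
  \<open>\<langle>e\<^sub>i, \<dots>, e\<^bsub>n+i\<^esub>\<rangle>\<close> by \<open>f\<^sub>k \<mapsto> e\<^sub>k\<close> for \<open>k \<ge> i\<close> and \<open>f\<^sub>k \<mapsto> e\<^bsub>n+1+k\<^esub>\<close> for \<open>k < i\<close>.  For \<open>v \<in> V\<^sub>i\<close> the vectors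
  \<open>\<phi>\<^sub>i(v)\<close> and \<open>\<phi>\<^bsub>i+1\<^esub>(pr\<^sub>i v)\<close> differ by a multiple of \<open>e\<^sub>i \<in> W\<^bsub>i+1\<^esub>\<close>, so the condition
  \<open>pr\<^sub>i(V\<^sub>i) \<subseteq> V\<^bsub>i+1\<^esub>\<close> becomes \<open>W\<^sub>i \<subseteq> W\<^bsub>i+1\<^esub>\<close>.  Hence \<open>\<zeta>\<close> is a bijection onto the set of flags with
  \<open>\<langle>e\<^sub>1, \<dots>, e\<^bsub>i-1\<^esub>\<rangle> \<subseteq> W\<^sub>i \<subseteq> \<langle>e\<^sub>1, \<dots>, e\<^bsub>n+i\<^esub>\<rangle>\<close>, called squeezed flags below, and it is equivariant since the torus acts
  on the \<open>i\<close>-th factor through the window.  In Pluecker coordinates \<open>\<zeta>\<close> and its inverse only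
  relabel coordinates, up to signs, and fill in zeros (\<open>row_minor_zeta_basis\<close>).  Both sets of flags are
  closed by the incidence relations (\<open>zariski_closed_incidence\<close>).  Together this is \<open>zeta_iso\<close>.

  It remains to identify the squeezed flags with the Schubert variety of \<open>\<sigma>\<close>.  They form a closed set
  containing the Borel orbit, so the point is that the orbit is dense
  (\<open>orbit_dense_in_squeezed_flag\<close>).  Every squeezed flag is spanned by parts of a
  basis \<open>w\<^sub>1, \<dots>, w\<^bsub>2n\<^esub>\<close> with \<open>w\<^sub>j \<in> e\<^sub>j + \<langle>e\<^sub>1, \<dots>, e\<^bsub>j-1\<^esub>\<rangle>\<close> (\<open>flag_of_exists\<close>), and its Borel orbit is
  determined by the indices \<open>a j\<close> at which the \<open>w\<^sub>j\<close> enter the flag.  If \<open>x < y\<close> and \<open>w\<^sub>x\<close> enters before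
  \<open>w\<^sub>y\<close>, then replacing \<open>w\<^sub>x\<close> by \<open>w\<^sub>x + t w\<^sub>y\<close> gives for \<open>t \<noteq> 0\<close> a flag in the orbit with the two indices
  exchanged (\<open>flag_of_transpose\<close>), and its limit for \<open>t \<rightarrow> 0\<close> is the given flag.  A counting argument
  (\<open>admissible_exchange\<close>) finds an exchange that leads to squeezed flags again, unless \<open>a\<close> belongs
  to \<open>\<sigma>\<close>; so after finitely many exchanges the orbit of \<open>\<sigma>\<close> is reached.\<close>

section \<open>Bases and minors\<close>

definition list_basis :: "cvec list \<Rightarrow> cvec set \<Rightarrow> bool" where
  "list_basis vs S \<longleftrightarrow> distinct vs \<and> cvec.independent (set vs) \<and> cvec.span (set vs) = S"

text \<open>The list \<open>r\<close> of rows may be unsorted and may have repetitions, so that minors can be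
  reindexed without signs of permutations; these enter only in \<open>row_sign\<close> below.\<close>

definition row_minor :: "cvec list \<Rightarrow> nat list \<Rightarrow> complex" where
  "row_minor vs r = det (mat (length vs) (length vs) (\<lambda>(a, b). (vs ! b) (r ! a)))"

abbreviation linear_map :: "(cvec \<Rightarrow> cvec) \<Rightarrow> bool" where
  "linear_map \<equiv> module_hom (\<lambda>c v k. c * v k) (\<lambda>c v k. c * v k)"

lemma linear_mapI:
  assumes "\<And>u v. f (u + v) = f u + f v" "\<And>c u. f (\<lambda>k. c * u k) = (\<lambda>k. c * f u k)"
  shows "linear_map f"
  using assms cvec.module_axioms by (auto simp: module_hom_iff)

lemma subspace_coord_space: "cvec.subspace (coord_space m)"
  by (rule cvec.subspaceI) (auto simp: coord_space_def)

lemma lin_comb_in_span: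
  "(\<lambda>x. \<Sum>b<k. c b * (vs b) x) \<in> cvec.span (vs ` {..<k})"
  for k :: nat
proof -
  have "(\<lambda>x. \<Sum>b<k. c b * (vs b) x) = (\<Sum>b<k. (\<lambda>x. c b * vs b x))"
    by (induction k) (auto simp: fun_eq_iff)
  also have "\<dots> \<in> cvec.span (vs ` {..<k})"
    by (intro cvec.span_sum cvec.span_scale cvec.span_base) auto
  finally show ?thesis .
qed

lemma span_list:
  assumes "v \<in> cvec.span (set vs)"
  obtains c where "v = (\<lambda>x. \<Sum>b<length vs. c b * (vs ! b) x)"
proof -
  have "\<exists>c. v = (\<lambda>x. \<Sum>b<length vs. c b * (vs ! b) x)" using assms
  proof (induction vs arbitrary: v)
    case Nil
    then show ?case by (auto simp: fun_eq_iff)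
  next
    case (Cons u vs)
    then obtain k where "v - (\<lambda>x. k * u x) \<in> cvec.span (set vs)"
      by (auto simp: cvec.span_insert)
    then obtain c where c: "v - (\<lambda>x. k * u x) = (\<lambda>x. \<Sum>b<length vs. c b * (vs ! b) x)"
      using Cons.IH by blast
    have "v = (\<lambda>x. \<Sum>b<length (u # vs). (case b of 0 \<Rightarrow> k | Suc b \<Rightarrow> c b) * ((u # vs) ! b) x)"
      using fun_cong[OF c] by (simp add: fun_eq_iff sum.lessThan_Suc_shift del: sum.lessThan_Suc) (metis diff_add_cancel add.commute)
    then show ?case by blast
  qed
  then show thesis using that by blast
qed

lemma span_list_mem:
  "(\<lambda>x. \<Sum>b<length vs. c b * (vs ! b) x) \<in> cvec.span (set vs)"
proof -
  have "(\<lambda>b. vs ! b) ` {..<length vs} = set vs" by (auto simp: set_conv_nth)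
  then show ?thesis using lin_comb_in_span[of c "\<lambda>b. vs ! b" "length vs"] by simp
qed

text \<open>The cofactors along a row do not see the entries of that row, so as a function of its first
  row index a minor is a fixed linear combination of the columns.\<close>

lemma row_minor_expand_first_row:
  "\<exists>c. \<forall>x. row_minor (u # vs) (x # r) =
     u x * row_minor vs r + (\<Sum>b<length vs. c b * (vs ! b) x)"
proof -
  let ?k = "length vs"
  let ?A = "\<lambda>x. mat (Suc ?k) (Suc ?k) (\<lambda>(a, b). ((u # vs) ! b) ((x # r) ! a))"
  have cof: "cofactor (?A x) 0 b = cofactor (?A 0) 0 b" if "b < Suc ?k" for x b
    unfolding cofactor_def mat_delete_def using that by (auto intro!: arg_cong[where f = det] eq_matI)
  have cof0: "cofactor (?A x) 0 0 = row_minor vs r" for x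
    unfolding cofactor_def mat_delete_def row_minor_def by (auto intro!: arg_cong[where f = det] eq_matI)
  have "row_minor (u # vs) (x # r) =
     u x * row_minor vs r + (\<Sum>b<length vs. cofactor (?A 0) 0 (Suc b) * (vs ! b) x)" for x
  proof -
    have "row_minor (u # vs) (x # r) = (\<Sum>b<Suc ?k. ?A x $$ (0, b) * cofactor (?A x) 0 b)"
      unfolding row_minor_def length_Cons by (rule laplace_expansion_row) auto
    also have "\<dots> = (\<Sum>b<Suc ?k. ((u # vs) ! b) x * cofactor (?A x) 0 b)"
      by (rule sum.cong) auto
    also have "\<dots> = u x * row_minor vs r + (\<Sum>b<?k. (vs ! b) x * cofactor (?A x) 0 (Suc b))"
      by (simp add: sum.lessThan_Suc_shift cof0 del: sum.lessThan_Suc)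
    also have "(\<Sum>b<?k. (vs ! b) x * cofactor (?A x) 0 (Suc b)) =
        (\<Sum>b<?k. cofactor (?A 0) 0 (Suc b) * (vs ! b) x)"
      by (intro sum.cong refl) (simp add: cof[of _ x] mult.commute)
    finally show ?thesis .
  qed
  then show ?thesis by (intro exI[of _ "\<lambda>b. cofactor (?A 0) 0 (Suc b)"] allI)
qed

text \<open>Induction on the number of vectors: if no row could be added to a nonzero minor of \<open>vs\<close>, the
  expansion along the new row would express \<open>u\<close> through \<open>vs\<close>, the coefficient of \<open>u\<close> being the
  old minor.\<close>

lemma independent_imp_row_minor_nonzero:
  assumes "distinct vs" "cvec.independent (set vs)" "set vs \<subseteq> coord_space m"
  shows "\<exists>r. length r = length vs \<and> set r \<subseteq> {1..m} \<and> row_minor vs r \<noteq> 0"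
  using assms
proof (induction vs)
  case Nil
  then show ?case by (auto simp: row_minor_def)
next
  case (Cons u vs)
  have "cvec.independent (set vs)"
    using Cons.prems(2) cvec.independent_mono by auto
  then obtain r where r: "length r = length vs" "set r \<subseteq> {1..m}" "row_minor vs r \<noteq> 0"
    using Cons by auto
  obtain c where c: "\<And>x. row_minor (u # vs) (x # r) =
     u x * row_minor vs r + (\<Sum>b<length vs. c b * (vs ! b) x)"
    using row_minor_expand_first_row by blast
  show ?case
  proof (rule ccontr)
    assume *: "\<not> ?case"
    have "u x * row_minor vs r + (\<Sum>b<length vs. c b * (vs ! b) x) = 0" for x
    proof (cases "x \<in> {1..m}")
      case True
      then have "length (x # r) = length (u # vs) \<and> set (x # r) \<subseteq> {1..m}" using r by auto
      then show ?thesis using * c by metis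
    next
      case False
      have "u x = 0" "\<And>b. b < length vs \<Longrightarrow> (vs ! b) x = 0"
        using False Cons.prems(3) nth_mem by (auto simp: coord_space_def, blast+)
      then show ?thesis by auto
    qed
    then have "u = (\<lambda>x. \<Sum>b<length vs. (- c b / row_minor vs r) * (vs ! b) x)"
      using r(3) by (intro ext) (simp add: sum_divide_distrib[symmetric] field_simps sum_negf eq_neg_iff_add_eq_0)
    then have "u \<in> cvec.span (set vs)"
      using span_list_mem[of "\<lambda>b. - c b / row_minor vs r" vs] by simp
    then show False
      using Cons.prems(1,2) by (simp add: cvec.independent_insert)
  qed
qed

text \<open>A linear relation between the vectors is a kernel vector of the submatrix.\<close>

lemma row_minor_nonzero_imp_trivial:
  assumes "row_minor vs r \<noteq> 0"
    "\<And>x. (\<Sum>b<length vs. c b * (vs ! b) x) = 0" "b < length vs"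
  shows "c b = 0"
proof -
  let ?k = "length vs"
  let ?A = "mat ?k ?k (\<lambda>(a, b). (vs ! b) (r ! a))"
  have "?A *\<^sub>v vec ?k c = 0\<^sub>v ?k"
    using assms(2) by (auto simp: scalar_prod_def lessThan_atLeast0 mult.commute)
  then have "vec ?k c = 0\<^sub>v ?k"
    using assms(1) det_0_iff_vec_prod_zero_field[of ?A ?k] vec_carrier[of ?k c]
    unfolding row_minor_def by (metis mat_carrier)
  then show ?thesis using assms(3) by (metis index_vec index_zero_vec(1))
qed

lemma row_minor_nonzero_imp_independent:
  assumes "row_minor vs r \<noteq> 0"
  shows "distinct vs" "cvec.independent (set vs)"
proof -
  show d: "distinct vs"
  proof (rule ccontr)
    assume "\<not> distinct vs"
    then obtain i j where ij: "i < length vs" "j < length vs" "i \<noteq> j" "vs ! i = vs ! j"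
      by (auto simp: distinct_conv_nth)
    let ?c = "\<lambda>b. if b = i then 1 else if b = j then -1 else (0::complex)"
    have "(\<Sum>b<length vs. ?c b * (vs ! b) x) = 0" for x
    proof -
      have "(\<Sum>b<length vs. ?c b * (vs ! b) x) = (\<Sum>b\<in>{i, j}. ?c b * (vs ! b) x)"
        using ij by (intro sum.mono_neutral_right) auto
      then show ?thesis using ij by auto
    qed
    then have "?c i = 0" using ij assms row_minor_nonzero_imp_trivial[of vs r ?c i] by blast
    then show False by simp
  qed
  show "cvec.independent (set vs)"
  proof (subst cvec.independent_explicit_finite_subsets, intro allI impI ballI)
    fix S u v assume S: "S \<subseteq> set vs" "finite S" "(\<Sum>v\<in>S. (\<lambda>k. u v * v k)) = 0" and v: "v \<in> S"
    let ?c = "\<lambda>b. if vs ! b \<in> S then u (vs ! b) else 0"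
    have "(\<Sum>b<length vs. ?c b * (vs ! b) x) = 0" for x
    proof -
      have "(\<Sum>b<length vs. ?c b * (vs ! b) x) = (\<Sum>v\<in>set vs. (if v \<in> S then u v else 0) * v x)"
        using sum.reindex_bij_betw[OF bij_betw_nth[OF d refl refl], of "\<lambda>v. (if v \<in> S then u v else 0) * v x"]
        by simp
      also have "\<dots> = (\<Sum>v\<in>S. u v * v x)"
        using S(1) by (intro sum.mono_neutral_cong_right) auto
      also have "\<dots> = (\<Sum>v\<in>S. (\<lambda>k. u v * v k)) x"
        using S(2) by (induction S) auto
      finally show ?thesis using S(3) by simp
    qed
    moreover obtain b where "b < length vs" "vs ! b = v" using v S(1) by (metis in_set_conv_nth subsetD)
    ultimately show "u v = 0" using assms row_minor_nonzero_imp_trivial[of vs r ?c b] v by auto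
  qed
qed

lemma row_minor_combine:
  assumes "length us = length vs"
    and "\<And>b x. b < length vs \<Longrightarrow> (vs ! b) x = (\<Sum>a<length us. C a b * (us ! a) x)"
  shows "row_minor vs r = row_minor us r * det (mat (length us) (length us) (\<lambda>(a, b). C a b))"
proof -
  let ?k = "length us"
  have "mat ?k ?k (\<lambda>(a, b). (vs ! b) (r ! a)) =
    mat ?k ?k (\<lambda>(a, b). (us ! b) (r ! a)) * mat ?k ?k (\<lambda>(a, b). C a b)"
    using assms by (intro eq_matI) (auto simp: scalar_prod_def lessThan_atLeast0 mult.commute)
  then show ?thesis unfolding row_minor_def assms(1)[symmetric]
    by (subst det_mult[symmetric, of _ ?k]) auto
qed

text \<open>The matrix of one basis is that of the other times a transition matrix, and the determinant
  of the latter is the common factor of all the minors.\<close>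

lemma row_minor_change_basis:
  assumes us: "list_basis us S" and vs: "list_basis vs S" and S: "S \<subseteq> coord_space m"
    and len: "length us = length vs"
  obtains c where "c \<noteq> 0" "\<And>r. row_minor vs r = c * row_minor us r"
proof -
  have "\<exists>C. \<forall>b<length vs. \<forall>x. (vs ! b) x = (\<Sum>a<length us. C b a * (us ! a) x)"
  proof -
    have "\<exists>c. (vs ! b) = (\<lambda>x. \<Sum>a<length us. c a * (us ! a) x)" if "b < length vs" for b
    proof -
      have "vs ! b \<in> cvec.span (set us)"
        using us vs that cvec.span_base[of "vs ! b" "set vs"] by (auto simp: list_basis_def)
      then show ?thesis using span_list by blast
    qed
    then show ?thesis by metis
  qed
  then obtain C where C: "\<And>b x. b < length vs \<Longrightarrow> (vs ! b) x = (\<Sum>a<length us. C b a * (us ! a) x)"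
    by blast
  let ?d = "det (mat (length us) (length us) (\<lambda>(a, b). C b a))"
  have eq: "row_minor vs r = row_minor us r * ?d" for r
    by (rule row_minor_combine[where C = "\<lambda>a b. C b a"]) (use C len in auto)
  have "set vs \<subseteq> coord_space m" using vs S cvec.span_superset by (auto simp: list_basis_def)
  then obtain r where "row_minor vs r \<noteq> 0"
    using independent_imp_row_minor_nonzero[of vs m] vs by (auto simp: list_basis_def)
  then have "?d \<noteq> 0" using eq by auto
  then show thesis using that[of ?d] eq by (simp add: mult.commute)
qed

lemma coord_space_span: "coord_space m = cvec.span (basis_vec ` {1..m})"
proof
  show "cvec.span (basis_vec ` {1..m}) \<subseteq> coord_space m"
    by (rule cvec.span_minimal[OF _ subspace_coord_space]) (auto simp: coord_space_def basis_vec_def)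
  show "coord_space m \<subseteq> cvec.span (basis_vec ` {1..m})"
  proof
    fix v assume v: "v \<in> coord_space m"
    have "v x = (\<Sum>b<m. v (Suc b) * basis_vec (Suc b) x)" for x
    proof (cases "x \<in> {1..m}")
      case True
      then have "(\<Sum>b<m. v (Suc b) * basis_vec (Suc b) x) = (\<Sum>b\<in>{x - 1}. v (Suc b) * basis_vec (Suc b) x)"
        by (intro sum.mono_neutral_right) (auto simp: basis_vec_def)
      then show ?thesis using True by (auto simp: basis_vec_def)
    next
      case False
      then have "(\<Sum>b<m. v (Suc b) * basis_vec (Suc b) x) = 0"
        by (intro sum.neutral) (auto simp: basis_vec_def)
      then show ?thesis using False v by (auto simp: coord_space_def)
    qed
    then have "v = (\<lambda>x. \<Sum>b<m. v (Suc b) * basis_vec (Suc b) x)" by (intro ext)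
    also have "\<dots> \<in> cvec.span ((\<lambda>b. basis_vec (Suc b)) ` {..<m})"
      by (rule lin_comb_in_span)
    also have "(\<lambda>b. basis_vec (Suc b)) ` {..<m} = basis_vec ` {1..m}"
      by (simp add: image_image[symmetric, of basis_vec Suc] image_Suc_lessThan)
    finally show "v \<in> cvec.span (basis_vec ` {1..m})" .
  qed
qed

lemma list_basis_dim: "list_basis vs S \<Longrightarrow> cvec.dim S = length vs"
  unfolding list_basis_def
  using cvec.dim_span_eq_card_independent distinct_card by metis

lemma list_basis_subspace: "list_basis vs S \<Longrightarrow> cvec.subspace S"
  unfolding list_basis_def by auto

lemma subspace_list_basis:
  assumes "cvec.subspace S" "S \<subseteq> coord_space m"
  obtains vs where "list_basis vs S" "length vs = cvec.dim S"
proof -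
  obtain B where B: "B \<subseteq> S" "cvec.independent B" "S \<subseteq> cvec.span B"
    using cvec.basis_exists[of S] by metis
  have "finite B"
    using cvec.independent_span_bound[of "basis_vec ` {1..m}" B] B(1,2) assms(2)
    unfolding coord_space_span by (meson finite_atLeastAtMost finite_imageI subset_trans)
  then obtain vs where vs: "set vs = B" "distinct vs" using finite_distinct_list by blast
  have "cvec.span B = S" using B assms(1) cvec.span_minimal by blast
  then have "list_basis vs S" using vs B by (auto simp: list_basis_def)
  then show thesis using that list_basis_dim[of vs S] by simp
qed

lemma Gr_iff: "S \<in> Gr k m \<longleftrightarrow> (\<exists>vs. list_basis vs S \<and> length vs = k) \<and> S \<subseteq> coord_space m"
proof
  assume "S \<in> Gr k m"
  then have S: "cvec.subspace S" "S \<subseteq> coord_space m" "cvec.dim S = k" by (auto simp: Gr_def)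
  obtain vs where "list_basis vs S" "length vs = cvec.dim S" using subspace_list_basis[OF S(1,2)] .
  then show "(\<exists>vs. list_basis vs S \<and> length vs = k) \<and> S \<subseteq> coord_space m" using S by blast
next
  assume "(\<exists>vs. list_basis vs S \<and> length vs = k) \<and> S \<subseteq> coord_space m"
  then show "S \<in> Gr k m" unfolding Gr_def using list_basis_dim list_basis_subspace by fastforce
qed

lemma list_basis_if_independent:
  assumes us: "list_basis us S" and "distinct vs" "cvec.independent (set vs)" "set vs \<subseteq> S"
    "length vs = length us"
  shows "list_basis vs S"
proof -
  have "cvec.span (set us) = S" "card (set us) = length us"
    using us by (auto simp: list_basis_def distinct_card)
  have "S \<subseteq> cvec.span (set vs)"
  proof
    fix u assume u: "u \<in> S"
    show "u \<in> cvec.span (set vs)"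
    proof (rule ccontr)
      assume *: "u \<notin> cvec.span (set vs)"
      then have "cvec.independent (insert u (set vs))"
        using assms(3) cvec.independent_insertI by blast
      moreover have "insert u (set vs) \<subseteq> cvec.span (set us)"
        using u assms us by (auto simp: list_basis_def)
      ultimately have "card (insert u (set vs)) \<le> card (set us)"
        using cvec.independent_span_bound[of "set us"] by blast
      moreover have "u \<notin> set vs" using * cvec.span_base by blast
      ultimately show False
        using assms(2,5) us by (simp add: list_basis_def distinct_card)
    qed
  qed
  moreover have "cvec.span (set vs) \<subseteq> S"
    using assms(4) list_basis_subspace[OF us] cvec.span_minimal by blast
  ultimately show ?thesis using assms by (auto simp: list_basis_def)
qed

lemma list_basis_if_spanning:
  assumes "cvec.span (set vs) = S" "cvec.dim S = length vs"
  shows "list_basis vs S"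
proof -
  obtain B where B: "B \<subseteq> set vs" "cvec.independent B" "set vs \<subseteq> cvec.span B"
    using cvec.maximal_independent_subset[of "set vs"] by metis
  have sp: "cvec.span B = S"
    using B assms by (metis cvec.span_mono cvec.span_span subset_antisym)
  then have "card B = length vs" using B(2) assms(2) cvec.dim_span_eq_card_independent by metis
  then have "B = set vs" "card (set vs) = length vs"
    using B(1) card_length[of vs] card_mono[of "set vs" B] card_subset_eq[of "set vs" B] by auto
  then show ?thesis using B(2) assms(1) card_distinct by (auto simp: list_basis_def)
qed

abbreviation drop_nth :: "nat \<Rightarrow> nat list \<Rightarrow> nat list" where
  "drop_nth a r \<equiv> take a r @ drop (Suc a) r"

lemma row_minor_expand_first_column:
  assumes r: "length r = Suc (length vs)"
  shows "row_minor (u # vs) r =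
    (\<Sum>a<Suc (length vs). u (r ! a) * ((-1) ^ a * row_minor vs (drop_nth a r)))"
proof -
  let ?k = "length vs"
  let ?A = "mat (Suc ?k) (Suc ?k) (\<lambda>(a, b). ((u # vs) ! b) (r ! a))"
  have cof: "cofactor ?A a 0 = (-1) ^ a * row_minor vs (drop_nth a r)" if "a < Suc ?k" for a
  proof -
    have "mat_delete ?A a 0 = mat ?k ?k (\<lambda>(i, b). (vs ! b) (drop_nth a r ! i))"
      unfolding mat_delete_def using that r
      by (intro eq_matI) (auto simp: nth_append min_def)
    then show ?thesis unfolding cofactor_def row_minor_def by simp
  qed
  have "row_minor (u # vs) r = (\<Sum>a<Suc ?k. ?A $$ (a, 0) * cofactor ?A a 0)"
    unfolding row_minor_def length_Cons by (rule laplace_expansion_column) auto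
  also have "\<dots> = (\<Sum>a<Suc ?k. u (r ! a) * ((-1) ^ a * row_minor vs (drop_nth a r)))"
    using cof by (intro sum.cong) auto
  finally show ?thesis .
qed

text \<open>The criterion \<open>u \<and> vs = 0\<close>, written in minors: adjoining \<open>u\<close> to a basis gives a dependent
  family exactly if \<open>u\<close> lies in the span.  Expanded along the column \<open>u\<close> the conditions become
  linear in the Pluecker coordinates.\<close>

lemma mem_iff_row_minors_vanish:
  assumes vs: "list_basis vs S" and S: "S \<subseteq> coord_space m" and u: "u \<in> coord_space m"
  shows "u \<in> S \<longleftrightarrow> (\<forall>r. length r = Suc (length vs) \<and> set r \<subseteq> {1..m} \<longrightarrow> row_minor (u # vs) r = 0)"
proof
  assume *: "u \<in> S"
  show "\<forall>r. length r = Suc (length vs) \<and> set r \<subseteq> {1..m} \<longrightarrow> row_minor (u # vs) r = 0"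
  proof (intro allI impI, rule ccontr)
    fix r assume "row_minor (u # vs) r \<noteq> 0"
    then have "distinct (u # vs)" "cvec.independent (set (u # vs))"
      using row_minor_nonzero_imp_independent by blast+
    then show False using * vs by (auto simp: list_basis_def cvec.independent_insert)
  qed
next
  assume *: "\<forall>r. length r = Suc (length vs) \<and> set r \<subseteq> {1..m} \<longrightarrow> row_minor (u # vs) r = 0"
  show "u \<in> S"
  proof (rule ccontr)
    assume "u \<notin> S"
    then have un: "u \<notin> cvec.span (set vs)" using vs by (auto simp: list_basis_def)
    then have "u \<notin> set vs" using cvec.span_base by blast
    then have "distinct (u # vs)" "cvec.independent (set (u # vs))"
      using vs un cvec.independent_insertI[OF un] by (auto simp: list_basis_def)
    moreover have "set (u # vs) \<subseteq> coord_space m"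
      using vs S u cvec.span_superset by (auto simp: list_basis_def)
    ultimately show False
      using independent_imp_row_minor_nonzero[of "u # vs" m] * by auto
  qed
qed

text \<open>Contracting a Pluecker vector with \<open>k - 1\<close> rows gives a vector of the subspace.  These
  contractions are polynomial in the Pluecker coordinates, unlike any choice of a basis, and by
  the next lemma there are enough of them.\<close>

lemma contraction_in_span:
  assumes "vs \<noteq> []"
  shows "(\<lambda>x. row_minor vs (x # s)) \<in> cvec.span (set vs)"
proof -
  obtain u us where vs: "vs = u # us" using assms by (cases vs) auto
  obtain c where c: "\<And>x. row_minor vs (x # s) =
     u x * row_minor us s + (\<Sum>b<length us. c b * (us ! b) x)"
    using row_minor_expand_first_row unfolding vs by blast
  have "(\<lambda>x. row_minor vs (x # s)) =
      (\<lambda>x. \<Sum>b<length vs. (case b of 0 \<Rightarrow> row_minor us s | Suc b \<Rightarrow> c b) * (vs ! b) x)"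
    unfolding c by (simp add: vs sum.lessThan_Suc_shift mult.commute del: sum.lessThan_Suc)
  then show ?thesis using span_list_mem by metis
qed

text \<open>This is Cramer's rule: for \<open>v\<close> in the span every minor of \<open>v # vs\<close> vanishes, and expanding the
  one with rows \<open>x # r\<close> along the column \<open>v\<close> solves for \<open>v x\<close>.\<close>

lemma span_by_contractions:
  assumes v: "v \<in> cvec.span (set vs)" and r: "length r = length vs" "row_minor vs r \<noteq> 0"
  shows "\<exists>d. v = (\<lambda>x. \<Sum>a<length vs. d a * row_minor vs (x # drop_nth a r))"
proof -
  let ?k = "length vs"
  have "row_minor (v # vs) (x # r) = 0" for x
  proof (rule ccontr)
    assume "row_minor (v # vs) (x # r) \<noteq> 0"
    then have "distinct (v # vs)" "cvec.independent (set (v # vs))"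
      using row_minor_nonzero_imp_independent by blast+
    then show False using v by (auto simp: cvec.independent_insert)
  qed
  then have "v x * row_minor vs r +
     (\<Sum>a<?k. v (r ! a) * ((-1) ^ Suc a * row_minor vs (x # drop_nth a r))) = 0" for x
    using row_minor_expand_first_column[of "x # r" vs v] r(1)
    by (simp add: sum.lessThan_Suc_shift del: sum.lessThan_Suc)
  then have *: "v x * row_minor vs r =
     (\<Sum>a<?k. v (r ! a) * ((-1) ^ a * row_minor vs (x # drop_nth a r)))" for x
    by (simp add: sum_negf eq_neg_iff_add_eq_0)
  have "v x = (\<Sum>a<?k. (v (r ! a) * (-1) ^ a / row_minor vs r) * row_minor vs (x # drop_nth a r))" for x
  proof -
    have "v x = (v x * row_minor vs r) / row_minor vs r" using r(2) by simp
    also have "\<dots> = (\<Sum>a<?k. (v (r ! a) * (-1) ^ a / row_minor vs r) * row_minor vs (x # drop_nth a r))"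
      unfolding * sum_divide_distrib by (intro sum.cong) auto
    finally show ?thesis .
  qed
  then show ?thesis by (intro exI[of _ "\<lambda>a. v (r ! a) * (-1) ^ a / row_minor vs r"] ext)
qed

section \<open>Pluecker coordinates\<close>

lemma plucker_eq: "plucker k m S = {plucker_vec k m vs | vs. length vs = k \<and> list_basis vs S}"
  unfolding plucker_def list_basis_def by simp

lemma plucker_vec_eq:
  "length vs = k \<Longrightarrow> plucker_vec k m vs =
     (\<lambda>J. if J \<subseteq> {1..m} \<and> card J = k then row_minor vs (sorted_list_of_set J) else 0)"
  unfolding plucker_vec_def row_minor_def by auto

text \<open>For distinct rows the factor is the sign of the permutation that sorts them, otherwise it is 0;
  in both cases it is the same for all families \<open>vs\<close>.\<close>

lemma row_minor_eq_plucker_coordinate: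
  assumes r: "length r = k" "set r \<subseteq> {1..m}"
  shows "\<exists>c. \<forall>vs. length vs = k \<longrightarrow> row_minor vs r = c * plucker_vec k m vs (set r)"
proof (cases "distinct r")
  case True
  let ?s = "sorted_list_of_set (set r)"
  have len: "length ?s = k" using True r by (simp add: distinct_card)
  have "mset ?s = mset r" using True by (simp add: set_eq_iff_mset_eq_distinct[symmetric])
  then obtain p where p: "p permutes {..<length ?s}" "permute_list p ?s = r"
    using mset_eq_permutation[of r ?s] by metis
  have "row_minor vs r = signof p * plucker_vec k m vs (set r)" if "length vs = k" for vs
  proof -
    let ?A = "mat k k (\<lambda>(a, b). (vs ! b) (?s ! a))"
    have "mat k k (\<lambda>(a, b). (vs ! b) (r ! a)) = mat k k (\<lambda>(i, j). ?A $$ (p i, j))"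
    proof (intro eq_matI; simp)
      fix i j assume ij: "i < k" "j < k"
      have "r ! i = ?s ! p i" using permute_list_nth[OF p(1), of i] ij len p(2) by simp
      moreover have "p i < k" using permutes_in_image[OF p(1), of i] ij len by simp
      ultimately show "(vs ! j) (r ! i) = ?A $$ (p i, j)" using ij by simp
    qed
    then have "row_minor vs r = signof p * det ?A"
      unfolding row_minor_def that using det_permute_rows[of ?A k p] p(1) len
      by (simp add: lessThan_atLeast0)
    moreover have "card (set r) = k" using True r(1) distinct_card by metis
    ultimately show ?thesis using that r by (simp add: plucker_vec_eq row_minor_def)
  qed
  then show ?thesis by blast
next
  case False
  then obtain i j where ij: "i < length r" "j < length r" "i \<noteq> j" "r ! i = r ! j"
    by (auto simp: distinct_conv_nth)
  have "row_minor vs r = 0" if "length vs = k" for vs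
    unfolding row_minor_def that
    by (rule det_identical_rows[where i = i and j = j]) (use ij r in auto)
  then show ?thesis by (intro exI[of _ 0]) auto
qed

definition row_sign :: "nat \<Rightarrow> nat \<Rightarrow> nat list \<Rightarrow> complex" where
  "row_sign k m r =
     (SOME c. \<forall>vs. length vs = k \<longrightarrow> row_minor vs r = c * plucker_vec k m vs (set r))"

text \<open>The minor with rows \<open>r\<close> of a basis of the \<open>i\<close>-th subspace, as a linear form in the
  homogeneous coordinates.\<close>

definition minor_coord :: "gr_product \<Rightarrow> nat \<Rightarrow> nat list \<Rightarrow> multicoords \<Rightarrow> complex" where
  "minor_coord G i r p = row_sign (rk G i) (amb G) r * p i (set r)"

lemma minor_coord_eq:
  assumes "length vs = rk G i" "length r = rk G i" "set r \<subseteq> {1..amb G}"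
    "p i = plucker_vec (rk G i) (amb G) vs"
  shows "minor_coord G i r p = row_minor vs r"
  using someI_ex[OF row_minor_eq_plucker_coordinate[OF assms(2,3)]] assms
  by (simp add: minor_coord_def row_sign_def)

text \<open>A nonzero scalar can be absorbed into the first basis vector; this needs one to exist, hence
  \<open>k \<ge> 1\<close>.\<close>

lemma plucker_scale:
  assumes q: "q \<in> plucker k m S" and k: "k \<ge> 1" and S: "S \<subseteq> coord_space m" and c: "c \<noteq> 0"
  shows "(\<lambda>J. c * q J) \<in> plucker k m S"
proof -
  obtain vs where vs: "q = plucker_vec k m vs" "length vs = k" "list_basis vs S"
    using q by (auto simp: plucker_eq)
  obtain u us where us: "vs = u # us" using vs k by (cases vs) auto
  let ?u = "\<lambda>x. c * u x"
  have minor: "row_minor (?u # us) r = c * row_minor vs r" if "length r = k" for r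
    using that vs(2) by (simp add: us row_minor_expand_first_column sum_distrib_left mult.assoc
        del: sum.lessThan_Suc)
  have vsS: "set vs \<subseteq> S" using vs cvec.span_superset by (auto simp: list_basis_def)
  then have "set vs \<subseteq> coord_space m" using S by auto
  then obtain r where r: "length r = k" "row_minor vs r \<noteq> 0"
    using independent_imp_row_minor_nonzero[of vs m] vs by (auto simp: list_basis_def)
  then have "row_minor (?u # us) r \<noteq> 0" using minor c by simp
  note ind = row_minor_nonzero_imp_independent[OF this]
  have "set (?u # us) \<subseteq> S"
    using vsS cvec.subspace_scale[OF list_basis_subspace[OF vs(3)]] by (auto simp: us)
  then have "list_basis (?u # us) S"
    using us by (intro list_basis_if_independent[OF vs(3) ind]) auto
  moreover have "plucker_vec k m (?u # us) = (\<lambda>J. c * q J)"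
    using vs(1,2) us minor by (auto simp: plucker_vec_eq fun_eq_iff)
  ultimately show ?thesis using vs(2) us by (auto simp: plucker_eq intro!: exI[of _ "?u # us"])
qed

section \<open>Multihomogeneous functions and closed conditions\<close>

lemma multihom_minor_coord:
  assumes "i \<in> {1..N}"
  shows "minor_coord G i r \<in> multihom N (\<lambda>j. if j = i then 1 else 0)"
proof -
  have "(\<lambda>p. row_sign (rk G i) (amb G) r * p i (set r)) \<in> poly_fun"
    by (intro poly_fun.intros)
  moreover have "(\<Prod>j\<in>{1..N}. c j ^ (if j = i then 1 else 0)) = c i" for c :: "nat \<Rightarrow> complex"
    using assms by (simp add: if_distrib[of "(^) _"] cong: if_cong)
  ultimately show ?thesis unfolding multihom_def minor_coord_def by (auto simp: minor_coord_def[abs_def])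
qed

lemma multihom_const: "(\<lambda>_. c) \<in> multihom N (\<lambda>_. 0)"
  unfolding multihom_def by (auto intro: poly_fun.intros)

lemma multihom_zero: "(\<lambda>_. 0) \<in> multihom N D"
  unfolding multihom_def by (auto intro: poly_fun.intros)

lemma multihom_add:
  "F \<in> multihom N D \<Longrightarrow> H \<in> multihom N D \<Longrightarrow> (\<lambda>p. F p + H p) \<in> multihom N D"
  unfolding multihom_def by (auto intro: poly_fun.intros simp: algebra_simps)

lemma multihom_sum:
  "(\<And>a. a \<in> A \<Longrightarrow> F a \<in> multihom N D) \<Longrightarrow> (\<lambda>p. \<Sum>a\<in>A. F a p) \<in> multihom N D"
  by (induction A rule: infinite_finite_induct) (auto intro: multihom_add multihom_zero)

lemma multihom_mult:
  "F \<in> multihom N D \<Longrightarrow> H \<in> multihom N D' \<Longrightarrow> (\<lambda>p. F p * H p) \<in> multihom N (\<lambda>i. D i + D' i)"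
  unfolding multihom_def by (auto intro: poly_fun.intros simp: power_add prod.distrib)

lemma multihom_cmult:
  "F \<in> multihom N D \<Longrightarrow> (\<lambda>p. c * F p) \<in> multihom N D"
  using multihom_mult[OF multihom_const] by simp

lemma hom_coords_exists:
  assumes "x \<in> points G"
  obtains p where "p \<in> hom_coords G x"
proof -
  have "\<exists>q. q \<in> plucker (rk G i) (amb G) (x i)" if "i \<in> {1..factors G}" for i
  proof -
    have "x i \<in> Gr (rk G i) (amb G)" using assms that by (auto simp: points_def)
    then show ?thesis by (auto simp: Gr_iff plucker_eq)
  qed
  then obtain q where "\<And>i. i \<in> {1..factors G} \<Longrightarrow> q i \<in> plucker (rk G i) (amb G) (x i)" by metis
  then have "(\<lambda>i. if i \<in> {1..factors G} then q i else (\<lambda>_. 0)) \<in> hom_coords G x"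
    by (auto simp: hom_coords_def)
  then show thesis using that by blast
qed

lemma hom_coords_basis:
  assumes "p \<in> hom_coords G x" "i \<in> {1..factors G}"
  obtains vs where "p i = plucker_vec (rk G i) (amb G) vs" "length vs = rk G i" "list_basis vs (x i)"
proof -
  have "p i \<in> plucker (rk G i) (amb G) (x i)" using assms by (simp add: hom_coords_def)
  then show thesis using that unfolding plucker_eq by blast
qed

lemma points_subset_coord_space:
  "x \<in> points G \<Longrightarrow> i \<in> {1..factors G} \<Longrightarrow> x i \<subseteq> coord_space (amb G)"
  by (auto simp: points_def Gr_def)

text \<open>As the homogeneous coordinates of a point form a nonempty set, testing the equations on all of
  them is the same as testing them on one.\<close>

lemma zariski_closedI:
  assumes "\<And>F. F \<in> \<F> \<Longrightarrow> \<exists>D. F \<in> multihom (factors G) D"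
    and "\<And>x p. x \<in> points G \<Longrightarrow> p \<in> hom_coords G x \<Longrightarrow> Q x \<longleftrightarrow> (\<forall>F\<in>\<F>. F p = 0)"
  shows "zariski_closed G {x \<in> points G. Q x}"
  unfolding zariski_closed_def
proof (intro exI[of _ \<F>] conjI)
  show "\<F> \<subseteq> (\<Union>D. multihom (factors G) D)" using assms(1) by auto
  show "{x \<in> points G. Q x} = {x \<in> points G. \<forall>F\<in>\<F>. \<forall>p\<in>hom_coords G x. F p = 0}"
  proof (intro Collect_cong conj_cong refl)
    fix x assume x: "x \<in> points G"
    obtain p where p: "p \<in> hom_coords G x" using hom_coords_exists[OF x] .
    show "Q x \<longleftrightarrow> (\<forall>F\<in>\<F>. \<forall>p\<in>hom_coords G x. F p = 0)"
      using assms(2)[OF x] p by blast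
  qed
qed

lemma zariski_closed_Ball:
  assumes "\<And>i. i \<in> I \<Longrightarrow> zariski_closed G {x \<in> points G. Q i x}"
  shows "zariski_closed G {x \<in> points G. \<forall>i\<in>I. Q i x}"
proof -
  have "\<exists>\<F>. \<forall>i\<in>I. \<F> i \<subseteq> (\<Union>D. multihom (factors G) D) \<and>
     {x \<in> points G. Q i x} = {x \<in> points G. \<forall>F\<in>\<F> i. \<forall>p\<in>hom_coords G x. F p = 0}"
    using assms unfolding zariski_closed_def by (intro bchoice) blast
  then obtain \<F> where F': "\<forall>i\<in>I. \<F> i \<subseteq> (\<Union>D. multihom (factors G) D) \<and>
     {x \<in> points G. Q i x} = {x \<in> points G. \<forall>F\<in>\<F> i. \<forall>p\<in>hom_coords G x. F p = 0}" ..
  have F: "\<F> i \<subseteq> (\<Union>D. multihom (factors G) D)"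
    "{x \<in> points G. Q i x} = {x \<in> points G. \<forall>F\<in>\<F> i. \<forall>p\<in>hom_coords G x. F p = 0}"
    if "i \<in> I" for i using bspec[OF F' that] by simp_all
  show ?thesis unfolding zariski_closed_def
  proof (intro exI[of _ "\<Union>i\<in>I. \<F> i"] conjI)
    show "(\<Union>i\<in>I. \<F> i) \<subseteq> (\<Union>D. multihom (factors G) D)" using F(1) by blast
    have "Q i x \<longleftrightarrow> (\<forall>F\<in>\<F> i. \<forall>p\<in>hom_coords G x. F p = 0)" if "i \<in> I" "x \<in> points G" for i x
    proof -
      have "x \<in> {x \<in> points G. Q i x} \<longleftrightarrow> x \<in> {x \<in> points G. \<forall>F\<in>\<F> i. \<forall>p\<in>hom_coords G x. F p = 0}"
        unfolding F(2)[OF that(1)] ..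
      then show ?thesis using that(2) by simp
    qed
    then show "{x \<in> points G. \<forall>i\<in>I. Q i x} =
       {x \<in> points G. \<forall>F\<in>\<Union>i\<in>I. \<F> i. \<forall>p\<in>hom_coords G x. F p = 0}" by auto
  qed
qed

lemma zariski_closed_conj:
  assumes "zariski_closed G {x \<in> points G. Q x}" "zariski_closed G {x \<in> points G. R x}"
  shows "zariski_closed G {x \<in> points G. Q x \<and> R x}"
proof -
  have "zariski_closed G {x \<in> points G. \<forall>b\<in>{True, False}. if b then Q x else R x}"
  proof (intro zariski_closed_Ball)
    fix b show "zariski_closed G {x \<in> points G. if b then Q x else R x}"
      using assms by (cases b) simp_all
  qed
  moreover have "(\<forall>b\<in>{True, False}. if b then Q x else R x) \<longleftrightarrow> Q x \<and> R x" for x by auto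
  ultimately show ?thesis by simp
qed

lemma zariski_closed_empty: "zariski_closed G {}"
  using zariski_closedI[of "{\<lambda>_. 1}" G "\<lambda>_. False"] multihom_const by auto


text \<open>This turns an inclusion of a point of the Grassmannian in a linear subspace into conditions
  on its Pluecker coordinates.\<close>

lemma subset_subspace_iff_contractions:
  assumes vs: "list_basis vs S" "vs \<noteq> []" and S: "S \<subseteq> coord_space m" and T: "cvec.subspace T"
  shows "S \<subseteq> T \<longleftrightarrow> (\<forall>s. length s = length vs - 1 \<and> set s \<subseteq> {1..m} \<longrightarrow>
    (\<lambda>x. row_minor vs (x # s)) \<in> T)"
proof
  assume "S \<subseteq> T"
  then show "\<forall>s. length s = length vs - 1 \<and> set s \<subseteq> {1..m} \<longrightarrow> (\<lambda>x. row_minor vs (x # s)) \<in> T"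
    using contraction_in_span[OF vs(2)] vs(1) by (auto simp: list_basis_def)
next
  assume *: "\<forall>s. length s = length vs - 1 \<and> set s \<subseteq> {1..m} \<longrightarrow> (\<lambda>x. row_minor vs (x # s)) \<in> T"
  have "set vs \<subseteq> coord_space m" using vs(1) S cvec.span_superset by (auto simp: list_basis_def)
  then obtain r where r: "length r = length vs" "set r \<subseteq> {1..m}" "row_minor vs r \<noteq> 0"
    using independent_imp_row_minor_nonzero[of vs m] vs by (auto simp: list_basis_def)
  show "S \<subseteq> T"
  proof
    fix v assume "v \<in> S"
    then have "v \<in> cvec.span (set vs)" using vs(1) by (simp add: list_basis_def)
    then obtain d where d: "v = (\<lambda>x. \<Sum>a<length vs. d a * row_minor vs (x # drop_nth a r))"
      using span_by_contractions[OF _ r(1,3)] by blast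
    have "v \<in> cvec.span ((\<lambda>a x. row_minor vs (x # drop_nth a r)) ` {..<length vs})"
      unfolding d by (rule lin_comb_in_span)
    also have "\<dots> \<subseteq> T"
    proof (intro cvec.span_minimal T image_subsetI)
      fix a assume a: "a \<in> {..<length vs}"
      have "length (drop_nth a r) = length vs - 1" using a r(1) by auto
      moreover have "set (drop_nth a r) \<subseteq> {1..m}"
        using r(2) set_take_subset[of a r] set_drop_subset[of "Suc a" r] by auto
      ultimately show "(\<lambda>x. row_minor vs (x # drop_nth a r)) \<in> T" using * by blast
    qed
    finally show "v \<in> T" .
  qed
qed

lemma drop_nth_props:
  assumes "length t = Suc k" "a < Suc k" "set t \<subseteq> A"
  shows "length (drop_nth a t) = k" "set (drop_nth a t) \<subseteq> A"
  using assms set_take_subset[of a t] set_drop_subset[of "Suc a" t] by auto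

text \<open>The maps \<open>pr i\<close> and the identity are the instances \<open>A = - {i}\<close> and \<open>A = UNIV\<close>.\<close>

definition coord_proj :: "nat set \<Rightarrow> cvec \<Rightarrow> cvec" where
  "coord_proj A v = (\<lambda>k. if k \<in> A then v k else 0)"

lemma linear_coord_proj: "linear_map (coord_proj A)"
  by (rule linear_mapI) (auto simp: coord_proj_def fun_eq_iff)

text \<open>The equations say that the image of every contraction of the \<open>i\<close>-th subspace lies in the
  \<open>j\<close>-th one.  They are bilinear in the two groups of Pluecker coordinates, which are the
  classical incidence relations.\<close>

lemma zariski_closed_incidence:
  assumes ij: "i \<in> {1..factors G}" "j \<in> {1..factors G}" and k: "rk G i \<ge> 1"
  shows "zariski_closed G {x \<in> points G. \<forall>v\<in>x i. coord_proj A v \<in> x j}"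
proof -
  let ?m = "amb G"
  \<comment> \<open>The minor with rows \<open>t\<close> of the projected contraction along \<open>s\<close> and a basis of the \<open>j\<close>-th subspace, expanded along its first column.\<close>
  define E where "E s t p = (\<Sum>a<Suc (rk G j). (if t ! a \<in> A then minor_coord G i (t ! a # s) p else 0) *
      ((-1) ^ a * minor_coord G j (drop_nth a t) p))" for s t p
  show ?thesis
  proof (rule zariski_closedI)
    fix F assume "F \<in> {E s t | s t. length s = rk G i - 1 \<and> set s \<subseteq> {1..?m} \<and>
      length t = Suc (rk G j) \<and> set t \<subseteq> {1..?m}}"
    then obtain s t where F: "F = E s t" by blast
    have "E s t \<in> multihom (factors G)
        (\<lambda>l. (if l = i then 1 else 0) + (if l = j then 1 else 0))"
      unfolding E_def[abs_def]
    proof (intro multihom_sum multihom_mult multihom_cmult multihom_minor_coord ij)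
      fix a
      show "(\<lambda>p. if t ! a \<in> A then minor_coord G i (t ! a # s) p else 0)
        \<in> multihom (factors G) (\<lambda>l. if l = i then 1 else 0)"
        using multihom_minor_coord[OF ij(1)] multihom_zero by (cases "t ! a \<in> A") auto
    qed
    then show "\<exists>D. F \<in> multihom (factors G) D" unfolding F by blast
  next
    fix x p assume x: "x \<in> points G" and p: "p \<in> hom_coords G x"
    obtain us where us: "p i = plucker_vec (rk G i) ?m us" "length us = rk G i" "list_basis us (x i)"
      using hom_coords_basis[OF p ij(1)] .
    obtain vs where vs: "p j = plucker_vec (rk G j) ?m vs" "length vs = rk G j" "list_basis vs (x j)"
      using hom_coords_basis[OF p ij(2)] .
    note sub = points_subset_coord_space[OF x]
    have us0: "us \<noteq> []" using us(2) k by auto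
    define ct where "ct s = (\<lambda>y. row_minor us (y # s))" for s
    have ct: "ct s \<in> x i" for s
      using contraction_in_span[OF us0] us(3) by (auto simp: list_basis_def ct_def)
    have E_eq: "E s t p = row_minor (coord_proj A (ct s) # vs) t"
      if "length s = rk G i - 1" "set s \<subseteq> {1..?m}" "length t = Suc (rk G j)" "set t \<subseteq> {1..?m}" for s t
    proof -
      have "row_minor (coord_proj A (ct s) # vs) t = (\<Sum>a<Suc (rk G j).
          coord_proj A (ct s) (t ! a) * ((-1) ^ a * row_minor vs (drop_nth a t)))"
        using that vs(2) by (subst row_minor_expand_first_column) (auto simp del: sum.lessThan_Suc)
      also have "\<dots> = E s t p"
        unfolding E_def
      proof (intro sum.cong refl)
        fix a assume a: "a \<in> {..<Suc (rk G j)}"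
        have ta: "t ! a \<in> {1..?m}" using that a by (metis lessThan_iff nth_mem subsetD)
        have "minor_coord G i (t ! a # s) p = ct s (t ! a)"
          unfolding ct_def by (rule minor_coord_eq) (use us that ta k in auto)
        moreover have "minor_coord G j (drop_nth a t) p = row_minor vs (drop_nth a t)"
          by (rule minor_coord_eq) (use vs that a drop_nth_props[of t "rk G j" a] in auto)
        ultimately show "coord_proj A (ct s) (t ! a) * ((-1) ^ a * row_minor vs (drop_nth a t)) =
          (if t ! a \<in> A then minor_coord G i (t ! a # s) p else 0) *
            ((-1) ^ a * minor_coord G j (drop_nth a t) p)" by (simp add: coord_proj_def)
      qed
      finally show ?thesis by simp
    qed
    have "(\<forall>v\<in>x i. coord_proj A v \<in> x j) \<longleftrightarrow> x i \<subseteq> {v. coord_proj A v \<in> x j}" by auto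
    also have "\<dots> \<longleftrightarrow> (\<forall>s. length s = rk G i - 1 \<and> set s \<subseteq> {1..?m} \<longrightarrow> coord_proj A (ct s) \<in> x j)"
      using subset_subspace_iff_contractions[OF us(3) us0 sub[OF ij(1)]
        module_hom.subspace_linear_preimage[OF linear_coord_proj list_basis_subspace[OF vs(3)]]] us(2) by (simp add: ct_def)
    also have "\<dots> \<longleftrightarrow> (\<forall>s. length s = rk G i - 1 \<and> set s \<subseteq> {1..?m} \<longrightarrow>
        (\<forall>t. length t = Suc (rk G j) \<and> set t \<subseteq> {1..?m} \<longrightarrow> row_minor (coord_proj A (ct s) # vs) t = 0))"
    proof -
      have "coord_proj A (ct s) \<in> coord_space ?m" for s
        using ct sub[OF ij(1)] by (fastforce simp: coord_proj_def coord_space_def)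
      then show ?thesis using mem_iff_row_minors_vanish[OF vs(3) sub[OF ij(2)]] vs(2) by simp
    qed
    also have "\<dots> \<longleftrightarrow> (\<forall>F\<in>{E s t | s t. length s = rk G i - 1 \<and> set s \<subseteq> {1..?m} \<and>
      length t = Suc (rk G j) \<and> set t \<subseteq> {1..?m}}. F p = 0)"
      (is "_ = ?rhs")
    proof -
      have "?rhs \<longleftrightarrow> (\<forall>s t. length s = rk G i - 1 \<and> set s \<subseteq> {1..?m} \<and>
          length t = Suc (rk G j) \<and> set t \<subseteq> {1..?m} \<longrightarrow> E s t p = 0)" by blast
      then show ?thesis by (simp add: E_eq cong: imp_cong) blast
    qed
    finally show "(\<forall>v\<in>x i. coord_proj A v \<in> x j) \<longleftrightarrow> \<dots>" .
  qed
qed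

lemma zariski_closed_contains:
  assumes j: "j \<in> {1..factors G}" and u: "u \<in> coord_space (amb G)"
  shows "zariski_closed G {x \<in> points G. u \<in> x j}"
proof -
  let ?m = "amb G"
  define E where "E t p = (\<Sum>a<Suc (rk G j). (u (t ! a) * (-1) ^ a) *
      minor_coord G j (drop_nth a t) p)" for t p
  show ?thesis
  proof (rule zariski_closedI)
    fix F assume "F \<in> {E t | t. length t = Suc (rk G j) \<and> set t \<subseteq> {1..?m}}"
    then obtain t where F: "F = E t" by blast
    have "E t \<in> multihom (factors G) (\<lambda>l. if l = j then 1 else 0)"
      unfolding E_def[abs_def] by (intro multihom_sum multihom_cmult multihom_minor_coord j)
    then show "\<exists>D. F \<in> multihom (factors G) D" unfolding F by blast
  next
    fix x p assume x: "x \<in> points G" and p: "p \<in> hom_coords G x"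
    obtain vs where vs: "p j = plucker_vec (rk G j) ?m vs" "length vs = rk G j" "list_basis vs (x j)"
      using hom_coords_basis[OF p j] .
    have E_eq: "E t p = row_minor (u # vs) t" if "length t = Suc (rk G j)" "set t \<subseteq> {1..?m}" for t
    proof -
      have "row_minor (u # vs) t = (\<Sum>a<Suc (rk G j). u (t ! a) * ((-1) ^ a * row_minor vs (drop_nth a t)))"
        using that vs(2) by (subst row_minor_expand_first_column) (auto simp del: sum.lessThan_Suc)
      also have "\<dots> = E t p" unfolding E_def
      proof (intro sum.cong refl)
        fix a assume a: "a \<in> {..<Suc (rk G j)}"
        have "minor_coord G j (drop_nth a t) p = row_minor vs (drop_nth a t)"
          by (rule minor_coord_eq) (use vs that a drop_nth_props[of t "rk G j" a] in auto)
        then show "u (t ! a) * ((-1) ^ a * row_minor vs (drop_nth a t)) =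
            (u (t ! a) * (-1) ^ a) * minor_coord G j (drop_nth a t) p" by simp
      qed
      finally show ?thesis by simp
    qed
    have "u \<in> x j \<longleftrightarrow> (\<forall>t. length t = Suc (rk G j) \<and> set t \<subseteq> {1..?m} \<longrightarrow> row_minor (u # vs) t = 0)"
      using mem_iff_row_minors_vanish[OF vs(3) points_subset_coord_space[OF x j] u] vs(2) by simp
    also have "\<dots> \<longleftrightarrow> (\<forall>F\<in>{E t | t. length t = Suc (rk G j) \<and> set t \<subseteq> {1..?m}}. F p = 0)"
      (is "_ = ?rhs")
    proof -
      have "?rhs \<longleftrightarrow> (\<forall>t. length t = Suc (rk G j) \<and> set t \<subseteq> {1..?m} \<longrightarrow> E t p = 0)" by blast
      then show ?thesis by (simp add: E_eq cong: imp_cong)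
    qed
    finally show "u \<in> x j \<longleftrightarrow> \<dots>" .
  qed
qed

lemma zariski_closed_coordinate_vanishes:
  assumes i: "i \<in> {1..factors G}" and k: "rk G i \<ge> 1" and y: "y \<in> {1..amb G}"
  shows "zariski_closed G {x \<in> points G. \<forall>v\<in>x i. v y = 0}"
proof (rule zariski_closedI)
  let ?m = "amb G"
  fix F assume "F \<in> {minor_coord G i (y # s) | s. length s = rk G i - 1 \<and> set s \<subseteq> {1..?m}}"
  then show "\<exists>D. F \<in> multihom (factors G) D" using multihom_minor_coord[OF i] by blast
next
  let ?m = "amb G"
  fix x p assume x: "x \<in> points G" and p: "p \<in> hom_coords G x"
  obtain us where us: "p i = plucker_vec (rk G i) ?m us" "length us = rk G i" "list_basis us (x i)"
    using hom_coords_basis[OF p i] .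
  have us0: "us \<noteq> []" using us(2) k by auto
  have sub: "cvec.subspace {v. v y = 0}" by (rule cvec.subspaceI) auto
  have eq: "minor_coord G i (y # s) p = row_minor us (y # s)"
    if "length s = rk G i - 1" "set s \<subseteq> {1..?m}" for s
    by (rule minor_coord_eq) (use us that k y in auto)
  have "(\<forall>v\<in>x i. v y = 0) \<longleftrightarrow> x i \<subseteq> {v. v y = 0}" by auto
  also have "\<dots> \<longleftrightarrow> (\<forall>s. length s = rk G i - 1 \<and> set s \<subseteq> {1..?m} \<longrightarrow> row_minor us (y # s) = 0)"
    using subset_subspace_iff_contractions[OF us(3) us0 points_subset_coord_space[OF x i] sub] us(2)
    by simp
  also have "\<dots> \<longleftrightarrow> (\<forall>F\<in>{minor_coord G i (y # s) | s. length s = rk G i - 1 \<and> set s \<subseteq> {1..?m}}. F p = 0)"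
    (is "_ = ?rhs")
  proof -
    have "?rhs \<longleftrightarrow> (\<forall>s. length s = rk G i - 1 \<and> set s \<subseteq> {1..?m} \<longrightarrow>
      minor_coord G i (y # s) p = 0)" by blast
    then show ?thesis by (simp add: eq cong: imp_cong)
  qed
  finally show "(\<forall>v\<in>x i. v y = 0) \<longleftrightarrow> \<dots>" .
qed

section \<open>The linear algebra of one component\<close>

lemma row_minor_zero_column:
  assumes "v \<in> set vs" "\<And>x. x \<in> set r \<Longrightarrow> v x = 0" "length r = length vs"
  shows "row_minor vs r = 0"
proof -
  obtain b where b: "b < length vs" "vs ! b = v" using assms(1) by (metis in_set_conv_nth)
  let ?A = "mat (length vs) (length vs) (\<lambda>(a, b). (vs ! b) (r ! a))"
  have "row_minor vs r = (\<Sum>a<length vs. ?A $$ (a, b) * cofactor ?A a b)"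
    unfolding row_minor_def using b by (intro laplace_expansion_column) auto
  also have "\<dots> = 0" using b assms by (intro sum.neutral) auto
  finally show ?thesis .
qed

lemma row_minor_zero_row:
  assumes "x \<in> set r" "\<And>v. v \<in> set vs \<Longrightarrow> v x = 0" "length r = length vs"
  shows "row_minor vs r = 0"
proof -
  obtain a where a: "a < length r" "r ! a = x" using assms(1) by (metis in_set_conv_nth)
  let ?A = "mat (length vs) (length vs) (\<lambda>(a, b). (vs ! b) (r ! a))"
  have "row_minor vs r = (\<Sum>b<length vs. ?A $$ (a, b) * cofactor ?A a b)"
    unfolding row_minor_def using a assms(3) by (intro laplace_expansion_row) auto
  also have "\<dots> = 0" using a assms by (intro sum.neutral) auto
  finally show ?thesis .
qed

text \<open>The rows \<open>q\<close> of the columns \<open>vs\<close> form the zero block of a block triangular matrix.\<close>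

lemma row_minor_append:
  assumes len: "length q = length us" "length r = length vs"
    and zero: "\<And>v x. v \<in> set vs \<Longrightarrow> x \<in> set q \<Longrightarrow> v x = 0"
  shows "row_minor (us @ vs) (q @ r) = row_minor us q * row_minor vs r"
proof -
  let ?k = "length us" and ?l = "length vs"
  let ?A = "mat ?k ?k (\<lambda>(a, b). (us ! b) (q ! a))" and ?D = "mat ?l ?l (\<lambda>(a, b). (vs ! b) (r ! a))"
    and ?C = "mat ?l ?k (\<lambda>(a, b). (us ! b) (r ! a))"
  have "mat (?k + ?l) (?k + ?l) (\<lambda>(a, b). ((us @ vs) ! b) ((q @ r) ! a)) =
      four_block_mat ?A (0\<^sub>m ?k ?l) ?C ?D"
    using len zero by (intro eq_matI) (auto simp: nth_append four_block_mat_def Let_def)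
  then show ?thesis
    unfolding row_minor_def length_append
    using det_four_block_mat_upper_right_zero[of ?A ?k "0\<^sub>m ?k ?l" ?l ?C ?D] by simp
qed

lemma row_minor_basis_vec: "distinct q \<Longrightarrow> row_minor (map basis_vec q) q = 1"
proof -
  assume d: "distinct q"
  have "mat (length q) (length q) (\<lambda>(a, b). (map basis_vec q ! b) (q ! a)) = 1\<^sub>m (length q)"
    using d by (intro eq_matI) (auto simp: basis_vec_def nth_eq_iff_index_eq)
  then show ?thesis by (simp add: row_minor_def)
qed

lemma row_minor_reindex:
  assumes "length r = length vs" "\<And>v x. v \<in> set vs \<Longrightarrow> x \<in> set r \<Longrightarrow> f v x = v (g x)"
  shows "row_minor (map f vs) r = row_minor vs (map g r)"
  using assms unfolding row_minor_def by (auto intro!: arg_cong[where f = det] eq_matI)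

text \<open>The component \<open>i\<close> of the isomorphism places \<open>V\<close> in the window \<open>{i..n + i}\<close> of coordinates of \<open>W\<close>:
  \<open>f\<^sub>k\<close> goes to \<open>e\<^sub>k\<close> for \<open>k \<ge> i\<close> and to \<open>e\<^bsub>n+1+k\<^esub>\<close> for \<open>k < i\<close>.  Thus \<open>pos\<close> is the position of the
  index \<open>k\<close> in the window, and its inverse \<open>slot\<close> does not depend on \<open>i\<close>.\<close>

definition slot :: "nat \<Rightarrow> nat \<Rightarrow> nat" where
  "slot n x = (if x \<le> n + 1 then x else x - (n + 1))"

definition pos :: "nat \<Rightarrow> nat \<Rightarrow> nat \<Rightarrow> nat" where
  "pos n i k = (if i \<le> k then k else n + 1 + k)"

definition to_window :: "nat \<Rightarrow> nat \<Rightarrow> cvec \<Rightarrow> cvec" where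
  "to_window n i w = (\<lambda>k. if k \<in> {1..n + 1} then w (pos n i k) else 0)"

definition from_window :: "nat \<Rightarrow> nat \<Rightarrow> cvec \<Rightarrow> cvec" where
  "from_window n i v = (\<lambda>x. if x \<in> {i..n + i} then v (slot n x) else 0)"

text \<open>The preimage of \<open>S\<close> under the projection of \<open>\<langle>e\<^sub>1, \<dots>, e\<^bsub>n+i\<^esub>\<rangle>\<close> onto the window, that is the sum of
  \<open>\<langle>e\<^sub>1, \<dots>, e\<^bsub>i-1\<^esub>\<rangle>\<close> and the copy of \<open>S\<close> in the window.\<close>

definition zeta_space :: "nat \<Rightarrow> nat \<Rightarrow> cvec set \<Rightarrow> cvec set" where
  "zeta_space n i S = {w \<in> coord_space (n + i). to_window n i w \<in> S}"

definition zeta_basis :: "nat \<Rightarrow> nat \<Rightarrow> cvec list \<Rightarrow> cvec list" where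
  "zeta_basis n i us = map basis_vec [1..<i] @ map (from_window n i) us"

lemma slot_pos: "k \<in> {1..n + 1} \<Longrightarrow> slot n (pos n i k) = k"
  by (auto simp: slot_def pos_def)

lemma pos_slot: "1 \<le> i \<Longrightarrow> i \<le> n \<Longrightarrow> x \<in> {i..n + i} \<Longrightarrow> pos n i (slot n x) = x"
  by (auto simp: slot_def pos_def)

lemma slot_range: "1 \<le> i \<Longrightarrow> i \<le> n \<Longrightarrow> x \<in> {i..n + i} \<Longrightarrow> slot n x \<in> {1..n + 1}"
  by (auto simp: slot_def)

lemma pos_range: "1 \<le> i \<Longrightarrow> i \<le> n \<Longrightarrow> k \<in> {1..n + 1} \<Longrightarrow> pos n i k \<in> {i..n + i}"
  by (auto simp: pos_def)

lemma linear_to_window: "linear_map (to_window n i)"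
  by (rule linear_mapI) (auto simp: to_window_def fun_eq_iff)

lemma linear_from_window: "linear_map (from_window n i)"
  by (rule linear_mapI) (auto simp: from_window_def fun_eq_iff)

lemmas subspace_to_window_image = module_hom.subspace_image[OF linear_to_window]

lemma subspace_zeta_space:
  assumes "cvec.subspace S"
  shows "cvec.subspace (zeta_space n i S)"
proof -
  have "zeta_space n i S = coord_space (n + i) \<inter> {w. to_window n i w \<in> S}"
    by (auto simp: zeta_space_def)
  then show ?thesis
    using assms module_hom.subspace_linear_preimage[OF linear_to_window, of S n i]
    by (simp add: cvec.subspace_inter subspace_coord_space)
qed

lemma to_window_in_coord_space: "to_window n i w \<in> coord_space (n + 1)"
  by (auto simp: to_window_def coord_space_def)

lemma from_window_in_coord_space: "1 \<le> i \<Longrightarrow> from_window n i v \<in> coord_space (n + i)"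
  by (auto simp: from_window_def coord_space_def)

lemma to_from_window:
  assumes "1 \<le> i" "i \<le> n" "v \<in> coord_space (n + 1)"
  shows "to_window n i (from_window n i v) = v"
proof
  fix k
  show "to_window n i (from_window n i v) k = v k"
    using assms pos_range[OF assms(1,2), of k] slot_pos[of k n i]
    by (cases "k \<in> {1..n + 1}") (auto simp: to_window_def from_window_def coord_space_def)
qed

lemma from_to_window:
  assumes "1 \<le> i" "i \<le> n"
  shows "from_window n i (to_window n i w) = (\<lambda>x. if x \<in> {i..n + i} then w x else 0)"
  using assms pos_slot slot_range by (auto simp: to_window_def from_window_def fun_eq_iff)

lemma to_window_basis_vec: "x < i \<Longrightarrow> i \<le> n \<Longrightarrow> to_window n i (basis_vec x) = 0"
  by (auto simp: to_window_def basis_vec_def pos_def fun_eq_iff)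

lemma kernel_to_window:
  assumes "1 \<le> i" "i \<le> n" "w \<in> coord_space (n + i)" "to_window n i w = 0"
  shows "w \<in> coord_space (i - 1)"
proof -
  have "w x = 0" if "x \<in> {i..n + i}" for x
  proof -
    have "from_window n i (to_window n i w) x = 0" using assms(4) by (simp add: from_window_def)
    then show ?thesis using that from_to_window[OF assms(1,2)] by simp
  qed
  then have "w k = 0" if "k \<notin> {1..i - 1}" for k
    using assms(3) that by (cases "k \<in> {i..n + i}") (auto simp: coord_space_def)
  then show ?thesis by (auto simp: coord_space_def)
qed

text \<open>The minors of the new subspace that use the first \<open>i - 1\<close> rows are the minors of the old one,
  because the added basis vectors contribute an identity block.\<close>

lemma row_minor_zeta_basis:
  assumes i: "1 \<le> i" "i \<le> n" and r: "length r = length us" "set r \<subseteq> {i..n + i}"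
  shows "row_minor (zeta_basis n i us) ([1..<i] @ r) = row_minor us (map (slot n) r)"
proof -
  have "row_minor (zeta_basis n i us) ([1..<i] @ r) =
      row_minor (map basis_vec [1..<i]) [1..<i] * row_minor (map (from_window n i) us) r"
    unfolding zeta_basis_def using r by (intro row_minor_append) (auto simp: from_window_def)
  also have "row_minor (map (from_window n i) us) r = row_minor us (map (slot n) r)"
    using r by (intro row_minor_reindex) (auto simp: from_window_def)
  finally show ?thesis by (simp add: row_minor_basis_vec)
qed

lemma row_minor_zeta_basis_pos:
  assumes i: "1 \<le> i" "i \<le> n" and r: "length r = length us" "set r \<subseteq> {1..n + 1}"
  shows "row_minor (zeta_basis n i us) ([1..<i] @ map (pos n i) r) = row_minor us r"
proof -
  have "set (map (pos n i) r) \<subseteq> {i..n + i}" using pos_range[OF i] r(2) by auto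
  moreover have "map (slot n) (map (pos n i) r) = r"
    using r(2) slot_pos by (auto intro!: map_idI)
  ultimately show ?thesis using row_minor_zeta_basis[OF i, of "map (pos n i) r" us] r(1) by simp
qed

lemma list_basis_zeta_basis:
  assumes i: "1 \<le> i" "i \<le> n" and us: "list_basis us S" and S: "S \<subseteq> coord_space (n + 1)"
  shows "list_basis (zeta_basis n i us) (zeta_space n i S)"
proof -
  have usS: "set us \<subseteq> S" using us cvec.span_superset by (auto simp: list_basis_def)
  then have "set us \<subseteq> coord_space (n + 1)" using S by auto
  then obtain r where r: "length r = length us" "set r \<subseteq> {1..n + 1}" "row_minor us r \<noteq> 0"
    using independent_imp_row_minor_nonzero[of us "n + 1"] us by (auto simp: list_basis_def)
  have "row_minor (zeta_basis n i us) ([1..<i] @ map (pos n i) r) \<noteq> 0"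
    using row_minor_zeta_basis_pos[OF i r(1,2)] r(3) by simp
  note ind = row_minor_nonzero_imp_independent[OF this]
  have sub: "cvec.subspace (zeta_space n i S)"
    using subspace_zeta_space list_basis_subspace[OF us] .
  have "cvec.span (set (zeta_basis n i us)) = zeta_space n i S"
  proof
    have "set (zeta_basis n i us) \<subseteq> zeta_space n i S"
    proof -
      have "basis_vec x \<in> zeta_space n i S" if "1 \<le> x" "x < i" for x
        using that to_window_basis_vec[OF that(2) i(2)] cvec.subspace_0[OF list_basis_subspace[OF us]] i
        by (auto simp: zeta_space_def coord_space_def basis_vec_def)
      moreover have "from_window n i u \<in> zeta_space n i S" if "u \<in> set us" for u
        using that usS S from_window_in_coord_space[OF i(1)] to_from_window[OF i]
        by (auto simp: zeta_space_def subset_iff)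
      ultimately show ?thesis by (auto simp: zeta_basis_def)
    qed
    then show "cvec.span (set (zeta_basis n i us)) \<subseteq> zeta_space n i S"
      using cvec.span_minimal sub by blast
    show "zeta_space n i S \<subseteq> cvec.span (set (zeta_basis n i us))"
    proof
      fix w assume w: "w \<in> zeta_space n i S"
      let ?w = "from_window n i (to_window n i w)"
      have "w - ?w \<in> coord_space (i - 1)"
        using w i by (auto simp: from_to_window[OF i] zeta_space_def coord_space_def)
      then have "w - ?w \<in> cvec.span (basis_vec ` {1..i - 1})" by (simp only: coord_space_span)
      moreover have "basis_vec ` {1..i - 1} \<subseteq> set (zeta_basis n i us)"
        using i by (auto simp: zeta_basis_def)
      ultimately have 1: "w - ?w \<in> cvec.span (set (zeta_basis n i us))"
        using cvec.span_mono by blast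
      have "set us \<subseteq> {v. from_window n i v \<in> cvec.span (set (zeta_basis n i us))}"
        by (auto simp: zeta_basis_def intro!: cvec.span_base)
      then have "S \<subseteq> {v. from_window n i v \<in> cvec.span (set (zeta_basis n i us))}"
        using us cvec.span_minimal[OF _ module_hom.subspace_linear_preimage[OF linear_from_window cvec.subspace_span]]
        unfolding list_basis_def by blast
      then have "?w \<in> cvec.span (set (zeta_basis n i us))"
        using w by (auto simp: zeta_space_def)
      from cvec.span_add[OF 1 this] show "w \<in> cvec.span (set (zeta_basis n i us))" by simp
    qed
  qed
  then show ?thesis using ind by (simp add: list_basis_def)
qed

text \<open>Every Pluecker coordinate of the new subspace is thus zero or, up to the sign contained in the
  reordering by \<open>slot\<close>, a Pluecker coordinate of the old one.\<close>

lemma row_minor_zeta_basis_sorted: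
  assumes i: "1 \<le> i" "i \<le> n" and us: "length us = i" and J: "J \<subseteq> {1..2 * n}" "card J = 2 * i - 1"
  shows "row_minor (zeta_basis n i us) (sorted_list_of_set J) =
    (if {1..<i} \<subseteq> J \<and> J \<subseteq> {1..n + i}
     then row_minor us (map (slot n) (sorted_list_of_set (J - {1..<i}))) else 0)"
proof -
  have fin: "finite J" using J finite_subset by blast
  have len: "length (sorted_list_of_set J) = length (zeta_basis n i us)"
    using us J i by (simp add: zeta_basis_def)
  show ?thesis
  proof (cases "{1..<i} \<subseteq> J \<and> J \<subseteq> {1..n + i}")
    case True
    have "sorted_list_of_set J = [1..<i] @ sorted_list_of_set (J - {1..<i})"
    proof (rule sorted_distinct_set_unique)
      show "sorted ([1..<i] @ sorted_list_of_set (J - {1..<i}))"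
        using fin True by (fastforce simp: sorted_append)
      show "distinct ([1..<i] @ sorted_list_of_set (J - {1..<i}))" using fin by auto
      show "set (sorted_list_of_set J) = set ([1..<i] @ sorted_list_of_set (J - {1..<i}))"
        using fin True by auto
    qed auto
    moreover have "card (J - {1..<i}) = i" using True J i by (simp add: card_Diff_subset)
    moreover have "J - {1..<i} \<subseteq> {i..n + i}" using True by auto
    ultimately show ?thesis
      using row_minor_zeta_basis[OF i, of "sorted_list_of_set (J - {1..<i})" us] True us fin
      by simp
  next
    case False
    then consider x where "x \<in> {1..<i}" "x \<notin> J" | x where "x \<in> J" "x \<notin> {1..n + i}" by blast
    then have "row_minor (zeta_basis n i us) (sorted_list_of_set J) = 0"
    proof cases
      case 1
      show ?thesis
        by (rule row_minor_zero_column[of "basis_vec x"])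
          (use 1 fin len in \<open>auto simp: zeta_basis_def basis_vec_def\<close>)
    next
      case 2
      show ?thesis
        by (rule row_minor_zero_row[of x])
          (use 2 fin len i in \<open>auto simp: zeta_basis_def basis_vec_def from_window_def\<close>)
    qed
    then show ?thesis by (simp only: if_not_P[OF False])
  qed
qed

section \<open>The isomorphism onto the squeezed flags\<close>

definition zeta :: "nat \<Rightarrow> point \<Rightarrow> point" where
  "zeta n V = (\<lambda>i\<in>{1..n}. zeta_space n i (V i))"

definition eta :: "nat \<Rightarrow> point \<Rightarrow> point" where
  "eta n W = (\<lambda>i\<in>{1..n}. to_window n i ` W i)"

text \<open>The explicit description of the Schubert variety that is proved below.\<close>

definition squeezed_flag :: "nat \<Rightarrow> point set" where
  "squeezed_flag n = {W \<in> odd_flag n. \<forall>i\<in>{1..n}. coord_space (i - 1) \<subseteq> W i \<and> W i \<subseteq> coord_space (n + i)}"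

lemma ambient_simps [simp]:
  "factors (deg_flag_ambient n) = n" "rk (deg_flag_ambient n) i = i" "amb (deg_flag_ambient n) = n + 1"
  "factors (odd_flag_ambient n) = n" "rk (odd_flag_ambient n) i = 2 * i - 1" "amb (odd_flag_ambient n) = 2 * n"
  by (simp_all add: deg_flag_ambient_def odd_flag_ambient_def)

lemma coord_space_mono: "k \<le> m \<Longrightarrow> coord_space k \<subseteq> coord_space m"
  by (auto simp: coord_space_def)

lemma zariski_closed_deg_flag: "zariski_closed (deg_flag_ambient n) (deg_flag n)"
proof -
  let ?G = "deg_flag_ambient n"
  have "zariski_closed ?G {V \<in> points ?G. \<forall>i\<in>{1..<n}. \<forall>v\<in>V i. coord_proj (- {i}) v \<in> V (i + 1)}"
    by (intro zariski_closed_Ball zariski_closed_incidence) auto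
  moreover have "coord_proj (- {i}) = pr i" for i
    by (auto simp: coord_proj_def pr_def fun_eq_iff)
  ultimately show ?thesis by (simp add: deg_flag_def image_subset_iff)
qed

text \<open>All the conditions are incidences with the next subspace or with coordinate subspaces.\<close>

lemma zariski_closed_squeezed_flag: "zariski_closed (odd_flag_ambient n) (squeezed_flag n)"
proof -
  let ?G = "odd_flag_ambient n"
  have "zariski_closed ?G {W \<in> points ?G. (\<forall>i\<in>{1..<n}. \<forall>v\<in>W i. coord_proj UNIV v \<in> W (i + 1)) \<and>
     (\<forall>i\<in>{1..n}. \<forall>x\<in>{1..i - 1}. basis_vec x \<in> W i) \<and>
     (\<forall>i\<in>{1..n}. \<forall>y\<in>{n + i + 1..2 * n}. \<forall>v\<in>W i. v y = 0)}"
    by (intro zariski_closed_conj zariski_closed_Ball zariski_closed_incidence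
        zariski_closed_contains zariski_closed_coordinate_vanishes)
      (auto simp: coord_space_def basis_vec_def)
  also have "{W \<in> points ?G. (\<forall>i\<in>{1..<n}. \<forall>v\<in>W i. coord_proj UNIV v \<in> W (i + 1)) \<and>
     (\<forall>i\<in>{1..n}. \<forall>x\<in>{1..i - 1}. basis_vec x \<in> W i) \<and>
     (\<forall>i\<in>{1..n}. \<forall>y\<in>{n + i + 1..2 * n}. \<forall>v\<in>W i. v y = 0)} = squeezed_flag n"
  proof -
    have "(\<forall>i\<in>{1..<n}. \<forall>v\<in>W i. coord_proj UNIV v \<in> W (i + 1)) \<longleftrightarrow> (\<forall>i\<in>{1..<n}. W i \<subseteq> W (i + 1))" for W :: point
      by (auto simp: coord_proj_def)
    moreover have "(\<forall>i\<in>{1..n}. \<forall>x\<in>{1..i - 1}. basis_vec x \<in> W i) \<longleftrightarrow>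
       (\<forall>i\<in>{1..n}. coord_space (i - 1) \<subseteq> W i)" if "W \<in> points ?G" for W
    proof (intro ball_cong refl)
      fix i assume "i \<in> {1..n}"
      then have "W i \<in> Gr (2 * i - 1) (2 * n)" using that by (auto simp: points_def)
      then have "cvec.subspace (W i)" by (simp add: Gr_def)
      then have "coord_space (i - 1) \<subseteq> W i \<longleftrightarrow> basis_vec ` {1..i - 1} \<subseteq> W i"
        unfolding coord_space_span
        using cvec.span_minimal[of "basis_vec ` {1..i - 1}" "W i"]
          cvec.span_superset[of "basis_vec ` {1..i - 1}"] by (meson subset_trans)
      then show "(\<forall>x\<in>{1..i - 1}. basis_vec x \<in> W i) \<longleftrightarrow> coord_space (i - 1) \<subseteq> W i"
        by (simp add: image_subset_iff)
    qed
    moreover have "(\<forall>i\<in>{1..n}. \<forall>y\<in>{n + i + 1..2 * n}. \<forall>v\<in>W i. v y = 0) \<longleftrightarrow>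
       (\<forall>i\<in>{1..n}. W i \<subseteq> coord_space (n + i))" if "W \<in> points ?G" for W
    proof (intro ball_cong refl)
      fix i assume i: "i \<in> {1..n}"
      have *: "v k = 0" if "v \<in> W i" "k \<notin> {1..2 * n}" for v k
        using points_subset_coord_space[OF \<open>W \<in> points ?G\<close>, of i] i that by (auto simp: coord_space_def)
      show "(\<forall>y\<in>{n + i + 1..2 * n}. \<forall>v\<in>W i. v y = 0) \<longleftrightarrow> W i \<subseteq> coord_space (n + i)"
      proof
        assume R: "\<forall>y\<in>{n + i + 1..2 * n}. \<forall>v\<in>W i. v y = 0"
        show "W i \<subseteq> coord_space (n + i)" unfolding coord_space_def
        proof (intro subsetI CollectI allI impI)
          fix v k assume v: "v \<in> W i" and k: "k \<notin> {1..n + i}"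
          show "v k = 0"
          proof (cases "k \<in> {1..2 * n}")
            case True
            then have "k \<in> {n + i + 1..2 * n}" using k by auto
            then show ?thesis using R v by blast
          qed (use * v in blast)
        qed
      qed (auto simp: coord_space_def)
    qed
    moreover have "squeezed_flag n = {W \<in> points ?G. (\<forall>i\<in>{1..<n}. W i \<subseteq> W (i + 1)) \<and>
        (\<forall>i\<in>{1..n}. coord_space (i - 1) \<subseteq> W i) \<and> (\<forall>i\<in>{1..n}. W i \<subseteq> coord_space (n + i))}"
      unfolding squeezed_flag_def odd_flag_def by blast
    ultimately show ?thesis
      by (simp only: cong: conj_cong)
  qed
  finally show ?thesis .
qed

text \<open>Passing from the window at \<open>i\<close> to the one at \<open>i + 1\<close> moves the index \<open>i\<close> from \<open>e\<^sub>i\<close> to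
  \<open>e\<^bsub>n+1+i\<^esub>\<close>, where \<open>w\<close> vanishes.  Hence the projections \<open>pr i\<close> of the degenerate flag variety
  correspond to inclusions.\<close>

lemma to_window_Suc:
  assumes "1 \<le> i" "i < n" "w \<in> coord_space (n + i)"
  shows "to_window n (i + 1) w = pr i (to_window n i w)"
  using assms by (auto simp: to_window_def pr_def pos_def coord_space_def fun_eq_iff)

lemma zeta_space_to_window_image:
  assumes i: "1 \<le> i" "i \<le> n" and S: "cvec.subspace S" "coord_space (i - 1) \<subseteq> S" "S \<subseteq> coord_space (n + i)"
  shows "zeta_space n i (to_window n i ` S) = S"
proof
  show "S \<subseteq> zeta_space n i (to_window n i ` S)" using S by (auto simp: zeta_space_def)
  show "zeta_space n i (to_window n i ` S) \<subseteq> S"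
  proof
    fix w assume "w \<in> zeta_space n i (to_window n i ` S)"
    then obtain w' where w: "w \<in> coord_space (n + i)" "w' \<in> S" "to_window n i w = to_window n i w'"
      by (auto simp: zeta_space_def)
    have "w - w' \<in> coord_space (n + i)"
      using w S(3) by (auto intro!: cvec.subspace_diff[OF subspace_coord_space])
    moreover have "to_window n i (w - w') = 0"
      using w(3) by (simp add: module_hom.diff[OF linear_to_window])
    ultimately have "w - w' \<in> S" using kernel_to_window[OF i] S(2) by blast
    then have "w' + (w - w') \<in> S" using w(2) cvec.subspace_add[OF S(1)] by blast
    then show "w \<in> S" by simp
  qed
qed

lemma to_window_image_zeta_space:
  assumes i: "1 \<le> i" "i \<le> n" and S: "S \<subseteq> coord_space (n + 1)"
  shows "to_window n i ` zeta_space n i S = S"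
proof
  show "to_window n i ` zeta_space n i S \<subseteq> S" by (auto simp: zeta_space_def)
  show "S \<subseteq> to_window n i ` zeta_space n i S"
  proof
    fix v assume v: "v \<in> S"
    then have "to_window n i (from_window n i v) = v" using to_from_window[OF i] S by blast
    then show "v \<in> to_window n i ` zeta_space n i S"
      using v from_window_in_coord_space[OF i(1)]
      by (intro image_eqI[of _ _ "from_window n i v"]) (simp_all add: zeta_space_def)
  qed
qed

lemma zeta_in_squeezed_flag:
  assumes V: "V \<in> deg_flag n"
  shows "zeta n V \<in> squeezed_flag n"
proof -
  have Vp: "V \<in> points (deg_flag_ambient n)" using V by (simp add: deg_flag_def)
  have Vi: "V i \<in> Gr i (n + 1)" if "i \<in> {1..n}" for i
    using Vp that by (auto simp: points_def)
  have "zeta_space n i (V i) \<in> Gr (2 * i - 1) (2 * n)" if i: "i \<in> {1..n}" for i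
  proof -
    obtain us where us: "list_basis us (V i)" "length us = i" using Vi[OF i] by (auto simp: Gr_iff)
    have "list_basis (zeta_basis n i us) (zeta_space n i (V i))"
      using list_basis_zeta_basis[OF _ _ us(1)] i Vi[OF i] by (auto simp: Gr_def)
    moreover have "length (zeta_basis n i us) = 2 * i - 1" using us i by (simp add: zeta_basis_def)
    moreover have "zeta_space n i (V i) \<subseteq> coord_space (2 * n)"
      using i coord_space_mono[of "n + i" "2 * n"] by (auto simp: zeta_space_def)
    ultimately show ?thesis by (auto simp: Gr_iff)
  qed
  then have "zeta n V \<in> points (odd_flag_ambient n)" by (auto simp: points_def zeta_def)
  moreover have "zeta n V i \<subseteq> zeta n V (i + 1)" if i: "i \<in> {1..<n}" for i
  proof
    fix w assume "w \<in> zeta n V i"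
    then have w: "w \<in> coord_space (n + i)" "to_window n i w \<in> V i"
      using i by (auto simp: zeta_def zeta_space_def)
    then have "to_window n (i + 1) w \<in> V (i + 1)"
      using to_window_Suc[of i n w] i V by (auto simp: deg_flag_def image_subset_iff)
    then show "w \<in> zeta n V (i + 1)"
      using i w coord_space_mono[of "n + i" "n + (i + 1)"] by (auto simp: zeta_def zeta_space_def)
  qed
  moreover have "coord_space (i - 1) \<subseteq> zeta n V i \<and> zeta n V i \<subseteq> coord_space (n + i)" if i: "i \<in> {1..n}" for i
  proof -
    have "0 \<in> V i" using Vi[OF i] cvec.subspace_0 by (auto simp: Gr_def)
    moreover have "to_window n i w = 0" if "w \<in> coord_space (i - 1)" for w
      using that i by (auto simp: to_window_def coord_space_def pos_def fun_eq_iff)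
    moreover have "coord_space (i - 1) \<subseteq> coord_space (n + i)"
      by (rule coord_space_mono) simp
    ultimately show ?thesis using i by (auto simp: zeta_def zeta_space_def)
  qed
  ultimately show ?thesis by (auto simp: squeezed_flag_def odd_flag_def)
qed

lemma squeezed_flagD:
  assumes W: "W \<in> squeezed_flag n" and i: "i \<in> {1..n}"
  shows "W i \<in> Gr (2 * i - 1) (2 * n)" "cvec.subspace (W i)"
    "coord_space (i - 1) \<subseteq> W i" "W i \<subseteq> coord_space (n + i)"
    "zeta_space n i (to_window n i ` W i) = W i"
proof -
  show "W i \<in> Gr (2 * i - 1) (2 * n)"
    using W i by (auto simp: squeezed_flag_def odd_flag_def points_def)
  then show "cvec.subspace (W i)" by (simp add: Gr_def)
  moreover show "coord_space (i - 1) \<subseteq> W i" "W i \<subseteq> coord_space (n + i)"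
    using W i by (auto simp: squeezed_flag_def)
  ultimately show "zeta_space n i (to_window n i ` W i) = W i"
    using zeta_space_to_window_image i by auto
qed

text \<open>The dimension of the image in the window is not known beforehand; it is computed by lifting a
  basis of the image back to a basis of \<open>W i\<close>, which has \<open>i - 1\<close> vectors more.\<close>

lemma eta_list_basis:
  assumes W: "W \<in> squeezed_flag n" and i: "i \<in> {1..n}"
  obtains us where "list_basis us (eta n W i)" "length us = i" "list_basis (zeta_basis n i us) (W i)"
    "eta n W i \<subseteq> coord_space (n + 1)"
proof -
  note Wi = squeezed_flagD[OF W i]
  have sub: "cvec.subspace (eta n W i)" "eta n W i \<subseteq> coord_space (n + 1)"
    using Wi(2) subspace_to_window_image to_window_in_coord_space i by (auto simp: eta_def)
  obtain us where us: "list_basis us (eta n W i)" using subspace_list_basis[OF sub] .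
  have zb: "list_basis (zeta_basis n i us) (W i)"
    using list_basis_zeta_basis[OF _ _ us sub(2), of i] Wi(5) i by (simp add: eta_def)
  have "length (zeta_basis n i us) = 2 * i - 1"
    using list_basis_dim[OF zb] Wi(1) by (simp add: Gr_def)
  then have "length us = i" using i by (auto simp: zeta_basis_def)
  then show thesis using that us zb sub by blast
qed

lemma eta_in_deg_flag:
  assumes W: "W \<in> squeezed_flag n"
  shows "eta n W \<in> deg_flag n"
proof -
  have "eta n W i \<in> Gr i (n + 1)" if i: "i \<in> {1..n}" for i
    using eta_list_basis[OF W i] by (metis Gr_iff)
  then have "eta n W \<in> points (deg_flag_ambient n)" by (auto simp: points_def eta_def)
  moreover have "pr i ` eta n W i \<subseteq> eta n W (i + 1)" if i: "i \<in> {1..<n}" for i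
  proof -
    have "W i \<subseteq> W (i + 1)" using W i by (auto simp: squeezed_flag_def odd_flag_def)
    moreover have "W i \<subseteq> coord_space (n + i)" using squeezed_flagD[OF W, of i] i by auto
    ultimately have "pr i (to_window n i w) \<in> to_window n (i + 1) ` W (i + 1)" if "w \<in> W i" for w
      using to_window_Suc[of i n w] i that by (metis atLeastLessThan_iff image_eqI subsetD)
    then show ?thesis using i by (auto simp: eta_def)
  qed
  ultimately show ?thesis by (simp add: deg_flag_def)
qed

lemma eta_zeta:
  assumes V: "V \<in> deg_flag n"
  shows "eta n (zeta n V) = V"
proof (rule PiE_ext)
  show "V \<in> (\<Pi>\<^sub>E i\<in>{1..n}. Gr i (n + 1))" using V by (simp add: deg_flag_def points_def)
  then have "V i \<subseteq> coord_space (n + 1)" if "i \<in> {1..n}" for i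
    using that by (auto simp: Gr_def)
  then show "eta n (zeta n V) i = V i" if "i \<in> {1..n}" for i
    using that to_window_image_zeta_space by (simp add: eta_def zeta_def)
  show "eta n (zeta n V) \<in> (\<Pi>\<^sub>E i\<in>{1..n}. Gr i (n + 1))"
    using eta_in_deg_flag[OF zeta_in_squeezed_flag[OF V]] by (simp add: deg_flag_def points_def)
qed

lemma zeta_eta:
  assumes W: "W \<in> squeezed_flag n"
  shows "zeta n (eta n W) = W"
proof (rule PiE_ext)
  show "W \<in> (\<Pi>\<^sub>E i\<in>{1..n}. Gr (2 * i - 1) (2 * n))"
    using W by (simp add: squeezed_flag_def odd_flag_def points_def)
  show "zeta n (eta n W) i = W i" if "i \<in> {1..n}" for i
    using that squeezed_flagD(5)[OF W that] by (simp add: eta_def zeta_def)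
  show "zeta n (eta n W) \<in> (\<Pi>\<^sub>E i\<in>{1..n}. Gr (2 * i - 1) (2 * n))"
    using zeta_in_squeezed_flag[OF eta_in_deg_flag[OF W]]
    by (simp add: squeezed_flag_def odd_flag_def points_def)
qed

lemma bij_betw_zeta: "bij_betw (zeta n) (deg_flag n) (squeezed_flag n)"
  by (rule bij_betw_byWitness[where f' = "eta n"])
    (auto simp: eta_zeta zeta_eta zeta_in_squeezed_flag eta_in_deg_flag)

text \<open>No denominators occur in the maps considered here, so the whole variety serves as the
  neighbourhood.\<close>

lemma regular_map_globalI:
  assumes "\<phi> \<in> X \<rightarrow> Y"
    and "\<And>j J. j \<in> {1..factors H} \<Longrightarrow> F j J \<in> multihom (factors G) (D j)"
    and "\<And>j y p. j \<in> {1..factors H} \<Longrightarrow> y \<in> X \<Longrightarrow> p \<in> hom_coords G y \<Longrightarrow>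
       (\<lambda>J. F j J p) \<in> plucker (rk H j) (amb H) (\<phi> y j)"
  shows "regular_map G X H Y \<phi>"
  unfolding regular_map_def using assms zariski_closed_empty[of G] by blast

text \<open>Each homogeneous coordinate of the image is zero or a single signed coordinate of the
  same component.\<close>

lemma regular_zeta:
  "regular_map (deg_flag_ambient n) (deg_flag n) (odd_flag_ambient n) (squeezed_flag n) (zeta n)"
proof (rule regular_map_globalI)
  let ?G = "deg_flag_ambient n"
  define F where "F i J = (if J \<subseteq> {1..2 * n} \<and> card J = 2 * i - 1 \<and> {1..<i} \<subseteq> J \<and> J \<subseteq> {1..n + i}
    then minor_coord ?G i (map (slot n) (sorted_list_of_set (J - {1..<i}))) else (\<lambda>_. 0))" for i J
  show "zeta n \<in> deg_flag n \<rightarrow> squeezed_flag n" using zeta_in_squeezed_flag by blast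
  show "F i J \<in> multihom (factors ?G) (\<lambda>j. if j = i then 1 else 0)"
    if "i \<in> {1..factors (odd_flag_ambient n)}" for i J
    using multihom_minor_coord[of i n ?G] multihom_zero that by (simp add: F_def)
  show "(\<lambda>J. F i J p) \<in> plucker (rk (odd_flag_ambient n) i) (amb (odd_flag_ambient n)) (zeta n V i)"
    if i': "i \<in> {1..factors (odd_flag_ambient n)}" and V: "V \<in> deg_flag n" and p: "p \<in> hom_coords ?G V" for i V p
  proof -
    have i: "1 \<le> i" "i \<le> n" using i' by auto
    obtain us where us: "p i = plucker_vec i (n + 1) us" "length us = i" "list_basis us (V i)"
      using hom_coords_basis[OF p, of i] i by auto
    have "V i \<subseteq> coord_space (n + 1)"
      using V i points_subset_coord_space[of V ?G i] by (auto simp: deg_flag_def)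
    then have zb: "list_basis (zeta_basis n i us) (zeta n V i)"
      using list_basis_zeta_basis[OF i us(3)] i by (simp add: zeta_def)
    have len: "length (zeta_basis n i us) = 2 * i - 1" using us i by (simp add: zeta_basis_def)
    have "F i J p = plucker_vec (2 * i - 1) (2 * n) (zeta_basis n i us) J" for J
    proof (cases "J \<subseteq> {1..2 * n} \<and> card J = 2 * i - 1")
      case J: True
      then have fin: "finite J" using finite_subset by blast
      have "minor_coord ?G i (map (slot n) (sorted_list_of_set (J - {1..<i}))) p =
          row_minor us (map (slot n) (sorted_list_of_set (J - {1..<i})))"
        if "{1..<i} \<subseteq> J" "J \<subseteq> {1..n + i}"
      proof (rule minor_coord_eq)
        have "card (J - {1..<i}) = i" using that J i by (simp add: card_Diff_subset)
        then show "length (map (slot n) (sorted_list_of_set (J - {1..<i}))) = rk ?G i" by simp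
        have "J - {1..<i} \<subseteq> {i..n + i}" using that by auto
        then have "slot n ` (J - {1..<i}) \<subseteq> {1..n + 1}" using slot_range[OF i] by blast
        then show "set (map (slot n) (sorted_list_of_set (J - {1..<i}))) \<subseteq> {1..amb ?G}"
          using fin by simp
      qed (use us in auto)
      then show ?thesis
        using row_minor_zeta_basis_sorted[OF i us(2), of J] J len
        by (simp add: F_def plucker_vec_eq)
    next
      case False
      then show ?thesis using len by (auto simp: F_def plucker_vec_eq)
    qed
    then show ?thesis using zb len by (auto simp: plucker_eq fun_eq_iff)
  qed
qed

text \<open>The coordinate \<open>J\<close> of \<open>\<langle>us\<rangle>\<close> is a coordinate of \<open>W i\<close> up to a factor that does not depend on \<open>J\<close>,
  namely the determinant of the change from \<open>zeta_basis n i us\<close> to the basis giving the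
  coordinates of \<open>W i\<close>; it is harmless by homogeneity.\<close>

lemma regular_eta:
  assumes \<phi>: "\<And>W. W \<in> squeezed_flag n \<Longrightarrow> \<phi> W = eta n W"
  shows "regular_map (odd_flag_ambient n) (squeezed_flag n) (deg_flag_ambient n) (deg_flag n) \<phi>"
proof (rule regular_map_globalI)
  let ?H = "odd_flag_ambient n"
  define F where "F i J = (if J \<subseteq> {1..n + 1} \<and> card J = i
    then minor_coord ?H i ([1..<i] @ map (pos n i) (sorted_list_of_set J)) else (\<lambda>_. 0))" for i J
  show "\<phi> \<in> squeezed_flag n \<rightarrow> deg_flag n" using eta_in_deg_flag \<phi> by auto
  show "F i J \<in> multihom (factors ?H) (\<lambda>j. if j = i then 1 else 0)"
    if "i \<in> {1..factors (deg_flag_ambient n)}" for i J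
    using multihom_minor_coord[of i n ?H] multihom_zero that by (simp add: F_def)
  show "(\<lambda>J. F i J p) \<in> plucker (rk (deg_flag_ambient n) i) (amb (deg_flag_ambient n)) (\<phi> W i)"
    if i': "i \<in> {1..factors (deg_flag_ambient n)}" and W: "W \<in> squeezed_flag n" and p: "p \<in> hom_coords ?H W" for i W p
  proof -
    have i: "1 \<le> i" "i \<le> n" "i \<in> {1..n}" using i' by auto
    obtain vs where vs: "p i = plucker_vec (2 * i - 1) (2 * n) vs" "length vs = 2 * i - 1" "list_basis vs (W i)"
      using hom_coords_basis[OF p, of i] i by auto
    obtain us where us: "list_basis us (eta n W i)" "length us = i" "list_basis (zeta_basis n i us) (W i)"
        "eta n W i \<subseteq> coord_space (n + 1)"
      using eta_list_basis[OF W i(3)] .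
    have len: "length (zeta_basis n i us) = length vs" using us vs i by (simp add: zeta_basis_def)
    obtain c where c: "c \<noteq> 0" "\<And>r. row_minor vs r = c * row_minor (zeta_basis n i us) r"
      by (rule row_minor_change_basis[OF us(3) vs(3) squeezed_flagD(4)[OF W i(3)] len]) (rule that)
    have "F i J p = c * plucker_vec i (n + 1) us J" for J
    proof (cases "J \<subseteq> {1..n + 1} \<and> card J = i")
      case J: True
      then have fin: "finite J" using finite_subset by blast
      have "minor_coord ?H i ([1..<i] @ map (pos n i) (sorted_list_of_set J)) p =
          row_minor vs ([1..<i] @ map (pos n i) (sorted_list_of_set J))"
      proof (rule minor_coord_eq)
        have "pos n i ` J \<subseteq> {1..2 * n}" using pos_range[OF i(1,2)] J i by force
        then show "set ([1..<i] @ map (pos n i) (sorted_list_of_set J)) \<subseteq> {1..amb ?H}"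
          using fin i by auto
      qed (use vs J i in auto)
      also have "\<dots> = c * row_minor us (sorted_list_of_set J)"
        using row_minor_zeta_basis_pos[OF i(1,2), of "sorted_list_of_set J" us] c(2) J us fin by simp
      finally show ?thesis using J us by (simp add: F_def plucker_vec_eq)
    next
      case False
      then show ?thesis using us by (auto simp: F_def plucker_vec_eq)
    qed
    moreover have "(\<lambda>J. c * plucker_vec i (n + 1) us J) \<in> plucker i (n + 1) (eta n W i)"
      by (rule plucker_scale) (use us c i in \<open>auto simp: plucker_eq\<close>)
    ultimately show ?thesis by (simp add: \<phi>[OF W])
  qed
qed

lemma zeta_iso:
  "projective_variety_iso (deg_flag_ambient n) (deg_flag n) (odd_flag_ambient n) (squeezed_flag n) (zeta n)"
proof -
  have "inv_into (deg_flag n) (zeta n) W = eta n W" if "W \<in> squeezed_flag n" for W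
    using bij_betw_zeta that eta_in_deg_flag zeta_eta by (metis bij_betw_inv_into_left)
  then have "regular_map (odd_flag_ambient n) (squeezed_flag n) (deg_flag_ambient n) (deg_flag n)
      (inv_into (deg_flag n) (zeta n))"
    by (rule regular_eta)
  then show ?thesis unfolding projective_variety_iso_def
    using zariski_closed_deg_flag zariski_closed_squeezed_flag bij_betw_zeta regular_zeta by blast
qed

section \<open>Squeezed flags and triangular bases\<close>

lemma diff_in_coord_space:
  assumes "u \<in> coord_space (Suc k)" "v \<in> coord_space (Suc k)" "u (Suc k) = v (Suc k)"
  shows "u - v \<in> coord_space k"
  unfolding coord_space_def
proof (intro CollectI allI impI)
  fix x assume "x \<notin> {1..k}"
  then show "(u - v) x = 0" using assms by (cases "x = Suc k") (auto simp: coord_space_def)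
qed

definition triangular :: "nat \<Rightarrow> (nat \<Rightarrow> cvec) \<Rightarrow> bool" where
  "triangular m w \<longleftrightarrow> (\<forall>j\<in>{1..m}. w j \<in> coord_space j \<and> w j j \<noteq> 0)"

lemma triangular_basis:
  assumes "triangular m w" "k \<le> m"
  shows "inj_on w {1..k} \<and> cvec.independent (w ` {1..k}) \<and> cvec.span (w ` {1..k}) = coord_space k"
  using assms(2)
proof (induction k)
  case 0
  have "coord_space 0 = {0}" by (auto simp: coord_space_def fun_eq_iff)
  then show ?case by (simp add: cvec.independent_empty)
next
  case (Suc k)
  then have IH: "inj_on w {1..k}" "cvec.independent (w ` {1..k})" "cvec.span (w ` {1..k}) = coord_space k"
    by auto
  have w: "w (Suc k) \<in> coord_space (Suc k)" "w (Suc k) (Suc k) \<noteq> 0"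
    using assms(1) Suc.prems by (auto simp: triangular_def)
  then have notin: "w (Suc k) \<notin> cvec.span (w ` {1..k})" unfolding IH(3) by (force simp: coord_space_def)
  have ins: "{1..Suc k} = insert (Suc k) {1..k}" by auto
  have "w (Suc k) \<notin> w ` {1..k}" using notin cvec.span_base by blast
  moreover have "cvec.span (w ` {1..Suc k}) = coord_space (Suc k)"
  proof
    show "cvec.span (w ` {1..Suc k}) \<subseteq> coord_space (Suc k)"
      using w(1) cvec.span_superset[of "w ` {1..k}"] coord_space_mono[of k "Suc k"]
      unfolding IH(3) ins by (intro cvec.span_minimal subspace_coord_space) auto
    show "coord_space (Suc k) \<subseteq> cvec.span (w ` {1..Suc k})"
    proof
      fix v assume v: "v \<in> coord_space (Suc k)"
      let ?c = "v (Suc k) / w (Suc k) (Suc k)"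
      have "v - (\<lambda>x. ?c * w (Suc k) x) \<in> coord_space k"
        using v w by (intro diff_in_coord_space cvec.subspace_scale subspace_coord_space) auto
      then show "v \<in> cvec.span (w ` {1..Suc k})"
        unfolding ins image_insert cvec.span_insert IH(3) by blast
    qed
  qed
  moreover have "inj_on w {1..Suc k}" "cvec.independent (w ` {1..Suc k})"
    unfolding ins image_insert
    using IH(1,2) \<open>w (Suc k) \<notin> w ` {1..k}\<close> cvec.independent_insertI[OF notin] by auto
  ultimately show ?case by blast
qed

text \<open>Here \<open>a j\<close> is the first index at which the basis vector \<open>w j\<close> belongs to the flag; the value
  \<open>n + 1\<close> stands for a vector outside of all its members.\<close>

definition flag_of :: "nat \<Rightarrow> (nat \<Rightarrow> cvec) \<Rightarrow> (nat \<Rightarrow> nat) \<Rightarrow> point" where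
  "flag_of n w a = (\<lambda>i\<in>{1..n}. cvec.span (w ` {j \<in> {1..2 * n}. a j \<le> i}))"

text \<open>The jump functions of squeezed flags: the cardinalities are the dimensions, and the two
  bounds on \<open>a j\<close> express \<open>\<langle>e\<^sub>1, \<dots>, e\<^bsub>i-1\<^esub>\<rangle> \<subseteq> W i\<close> and \<open>W i \<subseteq> \<langle>e\<^sub>1, \<dots>, e\<^bsub>n+i\<^esub>\<rangle>\<close>.\<close>

definition admissible :: "nat \<Rightarrow> (nat \<Rightarrow> nat) \<Rightarrow> bool" where
  "admissible n a \<longleftrightarrow>
     (\<forall>i\<in>{1..n}. card {j \<in> {1..2 * n}. a j \<le> i} = 2 * i - 1) \<and>
     (\<forall>j\<in>{1..2 * n}. 1 \<le> a j \<and> a j \<le> n + 1) \<and>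
     (\<forall>j\<in>{1..n}. a j \<le> j + 1) \<and> (\<forall>j\<in>{n + 1..2 * n}. j \<le> n + a j)"

lemma flag_of_in_squeezed_flag:
  assumes w: "triangular (2 * n) w" and a: "admissible n a"
  shows "flag_of n w a \<in> squeezed_flag n"
proof -
  let ?J = "\<lambda>i. {j \<in> {1..2 * n}. a j \<le> i}"
  note tb = triangular_basis[OF w order_refl]
  have wj: "w j \<in> coord_space j" if "j \<in> {1..2 * n}" for j using w that by (auto simp: triangular_def)
  have Gr: "cvec.span (w ` ?J i) \<in> Gr (2 * i - 1) (2 * n)" if i: "i \<in> {1..n}" for i
  proof -
    have "cvec.independent (w ` ?J i)"
      by (rule cvec.independent_mono[of "w ` {1..2 * n}"]) (use tb in auto)
    then have "cvec.dim (cvec.span (w ` ?J i)) = card (w ` ?J i)"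
      by (rule cvec.dim_span_eq_card_independent)
    also have "\<dots> = card (?J i)" by (rule card_image[OF inj_on_subset[OF conjunct1[OF tb]]]) auto
    also have "\<dots> = 2 * i - 1" using a i by (simp add: admissible_def)
    finally have "cvec.dim (cvec.span (w ` ?J i)) = 2 * i - 1" .
    moreover have "cvec.span (w ` ?J i) \<subseteq> coord_space (2 * n)"
      using tb cvec.span_mono[of "w ` ?J i" "w ` {1..2 * n}"] by fastforce
    ultimately show ?thesis by (simp add: Gr_def)
  qed
  have "coord_space (i - 1) \<subseteq> cvec.span (w ` ?J i)" if i: "i \<in> {1..n}" for i
  proof -
    have "{1..i - 1} \<subseteq> ?J i"
    proof
      fix j assume j: "j \<in> {1..i - 1}"
      then have "a j \<le> j + 1" using a i by (auto simp: admissible_def)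
      then show "j \<in> ?J i" using j i by auto
    qed
    then have "cvec.span (w ` {1..i - 1}) \<subseteq> cvec.span (w ` ?J i)"
      by (intro cvec.span_mono image_mono)
    then show ?thesis using triangular_basis[OF w, of "i - 1"] i by auto
  qed
  moreover have "cvec.span (w ` ?J i) \<subseteq> coord_space (n + i)" if i: "i \<in> {1..n}" for i
  proof (intro cvec.span_minimal subspace_coord_space image_subsetI)
    fix j assume j: "j \<in> ?J i"
    have "j \<le> n + i"
    proof (cases "j \<le> n")
      case False
      then have "j \<le> n + a j" using a j by (auto simp: admissible_def)
      then show ?thesis using j by auto
    qed auto
    then show "w j \<in> coord_space (n + i)" using wj[of j] j coord_space_mono[of j "n + i"] by auto
  qed
  moreover have "cvec.span (w ` ?J i) \<subseteq> cvec.span (w ` ?J (i + 1))" for i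
    by (intro cvec.span_mono image_mono) auto
  ultimately show ?thesis using Gr
    by (auto simp: squeezed_flag_def odd_flag_def points_def flag_of_def)
qed

text \<open>The Bruhat decomposition of a squeezed flag.  For each \<open>j\<close> take the first member of the flag
  that contains a vector \<open>e\<^sub>j + \<dots>\<close> with the dots in \<open>\<langle>e\<^sub>1, \<dots>, e\<^bsub>j-1\<^esub>\<rangle>\<close>, and choose such a vector there.
  Subtracting these vectors one leading term after the other shows that they generate.\<close>

lemma flag_of_exists:
  assumes W: "W \<in> squeezed_flag n"
  obtains w a where "triangular (2 * n) w" "\<And>j. j \<in> {1..2 * n} \<Longrightarrow> w j j = 1" "admissible n a"
    "W = flag_of n w a"
proof -
  define W' where "W' i = (if i \<le> n then W i else coord_space (2 * n))" for i
  define P where "P j i w \<longleftrightarrow> w \<in> W' i \<and> w \<in> coord_space j \<and> w j = 1" for j i and w :: cvec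
  \<comment> \<open>The whole space is appended at the index \<open>n + 1\<close>, so that every \<open>j\<close> has a jump.\<close>
  define a where "a j = (LEAST i. 1 \<le> i \<and> (\<exists>w. P j i w))" for j
  define w where "w j = (SOME w. P j (a j) w)" for j
  note Wi = squeezed_flagD[OF W]
  have top: "P j (n + 1) (basis_vec j)" if "j \<in> {1..2 * n}" for j
    using that by (auto simp: P_def W'_def basis_vec_def coord_space_def)
  have aP: "1 \<le> a j \<and> (\<exists>w. P j (a j) w)" if "j \<in> {1..2 * n}" for j
    unfolding a_def by (rule LeastI[of _ "n + 1"]) (use top[OF that] in auto)
  have a_le: "a j \<le> i" if "1 \<le> i" "P j i v" for i j v
    unfolding a_def using that by (intro Least_le) auto
  have wP: "P j (a j) (w j)" if "j \<in> {1..2 * n}" for j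
    unfolding w_def using aP[OF that] by (metis someI_ex)
  have a_top: "a j \<le> n + 1" if "j \<in> {1..2 * n}" for j
    using a_le[OF _ top[OF that]] by simp
  have tri: "triangular (2 * n) w" using wP by (simp add: triangular_def P_def)
  have Wmono: "W i \<subseteq> W k" if "1 \<le> i" "i \<le> k" "k \<le> n" for i k
    using that(2,3)
  proof (induction k rule: dec_induct)
    case (step k)
    then have "W k \<subseteq> W (k + 1)" using W that(1) by (auto simp: squeezed_flag_def odd_flag_def)
    then show ?case using step by auto
  qed simp
  have span: "W i = cvec.span (w ` {j \<in> {1..2 * n}. a j \<le> i})" (is "_ = cvec.span (w ` ?J)") if i: "i \<in> {1..n}" for i
  proof
    show "cvec.span (w ` ?J) \<subseteq> W i"
    proof (intro cvec.span_minimal Wi(2)[OF i] image_subsetI)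
      fix j assume j: "j \<in> ?J"
      then have "w j \<in> W (a j)" using wP[of j] i by (auto simp: P_def W'_def)
      then show "w j \<in> W i" using Wmono[of "a j" i] aP[of j] j i by auto
    qed
    have "v \<in> cvec.span (w ` ?J)" if "v \<in> W i" "v \<in> coord_space k" "k \<le> 2 * n" for v k
      using that
    proof (induction k arbitrary: v)
      case 0
      then have "v = 0" by (auto simp: coord_space_def fun_eq_iff)
      then show ?case by (simp only: cvec.span_zero)
    next
      case (Suc k)
      show ?case
      proof (cases "v (Suc k) = 0")
        case True
        then have "v \<in> coord_space k"
          using Suc.prems(2) by (auto simp: coord_space_def le_Suc_eq)
        then show ?thesis using Suc by auto
      next
        case False
        let ?c = "v (Suc k)"
        have "P (Suc k) i (\<lambda>x. (1 / ?c) * v x)"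
          unfolding P_def
        proof (intro conjI)
          show "(\<lambda>x. (1 / ?c) * v x) \<in> W' i"
            using i cvec.subspace_scale[OF Wi(2)[OF i] Suc.prems(1), of "1 / ?c"] by (simp add: W'_def)
          show "(\<lambda>x. (1 / ?c) * v x) \<in> coord_space (Suc k)"
            by (rule cvec.subspace_scale[OF subspace_coord_space Suc.prems(2)])
        qed (use False in simp)
        then have "a (Suc k) \<le> i" using a_le[of i "Suc k"] i by auto
        then have kJ: "Suc k \<in> ?J" using Suc.prems(3) by auto
        have wk: "w (Suc k) \<in> W i" "w (Suc k) \<in> coord_space (Suc k)" "w (Suc k) (Suc k) = 1"
          using wP[of "Suc k"] kJ i Wmono[of "a (Suc k)" i] aP[of "Suc k"] by (auto simp: P_def W'_def)
        let ?v = "v - (\<lambda>x. ?c * w (Suc k) x)"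
        have "?v \<in> W i"
          using Suc.prems(1) wk(1) Wi(2)[OF i] by (intro cvec.subspace_diff cvec.subspace_scale) auto
        moreover have "?v \<in> coord_space k"
          using Suc.prems(2) wk(2,3)
          by (intro diff_in_coord_space cvec.subspace_scale subspace_coord_space) auto
        ultimately have "?v \<in> cvec.span (w ` ?J)" using Suc by auto
        moreover have "(\<lambda>x. ?c * w (Suc k) x) \<in> cvec.span (w ` ?J)"
          using kJ by (intro cvec.span_scale cvec.span_base) auto
        ultimately have "?v + (\<lambda>x. ?c * w (Suc k) x) \<in> cvec.span (w ` ?J)" by (rule cvec.span_add)
        then show ?thesis by simp
      qed
    qed
    moreover have "W i \<subseteq> coord_space (2 * n)" using Wi(1)[OF i] by (auto simp: Gr_def)
    ultimately show "W i \<subseteq> cvec.span (w ` ?J)" by blast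
  qed
  note tb = triangular_basis[OF tri order_refl]
  have "card {j \<in> {1..2 * n}. a j \<le> i} = 2 * i - 1" (is "card ?J = _") if i: "i \<in> {1..n}" for i
  proof -
    have "cvec.independent (w ` ?J)"
      by (rule cvec.independent_mono[of "w ` {1..2 * n}"]) (use tb in auto)
    then have "cvec.dim (W i) = card (w ` ?J)"
      unfolding span[OF i] by (rule cvec.dim_span_eq_card_independent)
    also have "\<dots> = card ?J" by (rule card_image[OF inj_on_subset[OF conjunct1[OF tb]]]) auto
    finally show ?thesis using Wi(1)[OF i] by (simp add: Gr_def)
  qed
  moreover have "a j \<le> j + 1" if j: "j \<in> {1..n}" for j
  proof (cases "j = n")
    case True
    then show ?thesis using a_top[of j] j by auto
  next
    case False
    then have "basis_vec j \<in> W (j + 1)"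
      using Wi(3)[of "j + 1"] j by (auto simp: coord_space_def basis_vec_def subset_iff)
    then have "P j (j + 1) (basis_vec j)"
      using j False by (auto simp: P_def W'_def coord_space_def basis_vec_def)
    then show ?thesis using a_le by auto
  qed
  moreover have "j \<le> n + a j" if j: "j \<in> {n + 1..2 * n}" for j
  proof (cases "a j \<le> n")
    case True
    then have "w j \<in> coord_space (n + a j)" "w j j = 1"
      using wP[of j] aP[of j] Wi(4)[of "a j"] j by (auto simp: P_def W'_def)
    then show ?thesis by (auto simp: coord_space_def)
  qed (use j in auto)
  ultimately have "admissible n a" using aP a_top by (auto simp: admissible_def)
  moreover have "W = flag_of n w a"
  proof (rule PiE_ext)
    show "W \<in> (\<Pi>\<^sub>E i\<in>{1..n}. Gr (2 * i - 1) (2 * n))"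
      using W by (simp add: squeezed_flag_def odd_flag_def points_def)
    show "flag_of n w a \<in> (\<Pi>\<^sub>E i\<in>{1..n}. Gr (2 * i - 1) (2 * n))"
      using Wi(1) span by (auto simp: flag_of_def)
    show "W i = flag_of n w a i" if "i \<in> {1..n}" for i using span[OF that] that by (simp add: flag_of_def)
  qed
  ultimately show thesis using that tri wP by (auto simp: P_def)
qed

section \<open>The Borel orbit\<close>

text \<open>The jump function of the coordinate flag of \<open>sigma n\<close>.\<close>

definition open_jumps :: "nat \<Rightarrow> nat \<Rightarrow> nat" where
  "open_jumps n j = (if j \<le> n then j + 1 else j - n)"

lemma sigma_image:
  assumes "i \<in> {1..n}"
  shows "sigma n ` {1..2 * i - 1} = {j \<in> {1..2 * n}. open_jumps n j \<le> i}"
proof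
  show "sigma n ` {1..2 * i - 1} \<subseteq> {j \<in> {1..2 * n}. open_jumps n j \<le> i}"
    using assms by (auto simp: sigma_def open_jumps_def elim!: evenE oddE)
  show "{j \<in> {1..2 * n}. open_jumps n j \<le> i} \<subseteq> sigma n ` {1..2 * i - 1}"
  proof
    fix j assume j: "j \<in> {j \<in> {1..2 * n}. open_jumps n j \<le> i}"
    show "j \<in> sigma n ` {1..2 * i - 1}"
    proof (cases "j \<le> n")
      case True
      then have "j = sigma n (2 * j)" "2 * j \<in> {1..2 * i - 1}"
        using j sigma_even[of j n] by (auto simp: open_jumps_def)
      then show ?thesis by blast
    next
      case False
      then have "j = sigma n (2 * (j - n - 1) + 1)" "2 * (j - n - 1) + 1 \<in> {1..2 * i - 1}"
        using j sigma_odd[of "j - n - 1" n] by (auto simp: open_jumps_def)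
      then show ?thesis by blast
    qed
  qed
qed

lemma admissible_open_jumps: "admissible n (open_jumps n)"
  unfolding admissible_def
proof (intro conjI ballI)
  fix i assume i: "i \<in> {1..n}"
  have "inj_on (sigma n) {1..2 * i - 1}"
    using permutes_inj[OF sigma_permutes] inj_on_subset by blast
  then show "card {j \<in> {1..2 * n}. open_jumps n j \<le> i} = 2 * i - 1"
    unfolding sigma_image[OF i, symmetric] by (simp add: card_image)
qed (auto simp: open_jumps_def)

lemma linear_mat_apply: "linear_map (mat_apply A)"
  by (rule linear_mapI) (auto simp: mat_apply_def fun_eq_iff algebra_simps sum.distrib sum_distrib_left)

lemma mat_apply_basis_vec:
  assumes "j \<in> {1..dim_col A}"
  shows "mat_apply A (basis_vec j) = (\<lambda>i. if i \<in> {1..dim_row A} then A $$ (i - 1, j - 1) else 0)"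
proof
  fix i
  have "(\<Sum>l\<in>{1..dim_col A}. A $$ (i - 1, l - 1) * basis_vec j l) = A $$ (i - 1, j - 1)"
    using assms by (simp add: basis_vec_def if_distrib[of "(*) _"] cong: if_cong)
  then show "mat_apply A (basis_vec j) i = (if i \<in> {1..dim_row A} then A $$ (i - 1, j - 1) else 0)"
    by (simp add: mat_apply_def)
qed

lemma flag_act_coord_flag:
  "flag_act n A (coord_flag n (sigma n)) = flag_of n (\<lambda>j. mat_apply A (basis_vec j)) (open_jumps n)"
proof
  fix i
  show "flag_act n A (coord_flag n (sigma n)) i = flag_of n (\<lambda>j. mat_apply A (basis_vec j)) (open_jumps n) i"
  proof (cases "i \<in> {1..n}")
    case True
    have "(\<lambda>j. mat_apply A (basis_vec j)) ` {j \<in> {1..2 * n}. open_jumps n j \<le> i} =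
      mat_apply A ` (\<lambda>k. basis_vec (sigma n k)) ` {1..2 * i - 1}"
      unfolding sigma_image[OF True, symmetric] by (simp add: image_image)
    then show ?thesis
      using True by (simp add: flag_act_def coord_flag_def flag_of_def module_hom.span_image[OF linear_mat_apply])
  qed (auto simp: flag_act_def flag_of_def)
qed

lemma orbit_in_squeezed_flag:
  assumes A: "A \<in> borel_group n"
  shows "flag_act n A (coord_flag n (sigma n)) \<in> squeezed_flag n"
proof -
  have A': "A \<in> carrier_mat (2 * n) (2 * n)" "upper_triangular A" "det A = 1"
    using A by (auto simp: borel_group_def)
  have "prod_list (diag_mat A) \<noteq> 0" using det_upper_triangular[OF A'(2,1)] A'(3) by simp
  then have diag: "A $$ (k, k) \<noteq> 0" if "k < 2 * n" for k
    using that A'(1) by (auto simp: prod_list_zero_iff diag_mat_def)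
  have "triangular (2 * n) (\<lambda>j. mat_apply A (basis_vec j))"
    unfolding triangular_def
  proof (intro ballI conjI)
    fix j assume j: "j \<in> {1..2 * n}"
    have eq: "mat_apply A (basis_vec j) = (\<lambda>i. if i \<in> {1..2 * n} then A $$ (i - 1, j - 1) else 0)"
      using mat_apply_basis_vec[of j A] j A'(1) by auto
    have "A $$ (i - 1, j - 1) = 0" if "i \<in> {1..2 * n}" "i > j" for i
      using upper_triangularD[OF A'(2), of "j - 1" "i - 1"] that j A'(1) by auto
    then show "mat_apply A (basis_vec j) \<in> coord_space j"
      unfolding eq coord_space_def by auto
    show "mat_apply A (basis_vec j) j \<noteq> 0"
      unfolding eq using diag[of "j - 1"] j by force
  qed
  then show ?thesis unfolding flag_act_coord_flag
    using admissible_open_jumps by (intro flag_of_in_squeezed_flag)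
qed

lemma flag_of_open_jumps_in_orbit:
  assumes w: "triangular (2 * n) w" "\<And>j. j \<in> {1..2 * n} \<Longrightarrow> w j j = 1"
  shows "flag_of n w (open_jumps n) \<in> (\<lambda>A. flag_act n A (coord_flag n (sigma n))) ` borel_group n"
proof -
  define A where "A = mat (2 * n) (2 * n) (\<lambda>(a, b). w (Suc b) (Suc a))"
  have A: "A \<in> carrier_mat (2 * n) (2 * n)" by (simp add: A_def)
  have up: "upper_triangular A"
  proof
    fix i j assume "j < i" "i < dim_row A"
    moreover from this have "w (Suc j) \<in> coord_space (Suc j)"
      using w(1) A by (auto simp: triangular_def)
    ultimately show "A $$ (i, j) = 0" using A by (auto simp: A_def coord_space_def)
  qed
  have "diag_mat A = map (\<lambda>_. 1) [0..<2 * n]"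
    using w(2) by (auto simp: diag_mat_def A_def)
  then have "det A = 1"
    using det_upper_triangular[OF up A] by (simp add: map_replicate_const)
  then have AB: "A \<in> borel_group n" using A up by (simp add: borel_group_def)
  have "mat_apply A (basis_vec j) = w j" if j: "j \<in> {1..2 * n}" for j
  proof -
    have "w j \<in> coord_space j" using w(1) j by (auto simp: triangular_def)
    then have "w j i = 0" if "i \<notin> {1..2 * n}" for i using that j by (auto simp: coord_space_def)
    moreover have "mat_apply A (basis_vec j) = (\<lambda>i. if i \<in> {1..2 * n} then A $$ (i - 1, j - 1) else 0)"
      using mat_apply_basis_vec[of j A] j A by auto
    ultimately show ?thesis using j by (auto simp: A_def fun_eq_iff)
  qed
  then have "flag_of n w (open_jumps n) = flag_act n A (coord_flag n (sigma n))"
    unfolding flag_act_coord_flag flag_of_def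
    by (intro restrict_ext arg_cong[where f = cvec.span] image_cong) auto
  then show ?thesis using AB by blast
qed

section \<open>Limits of flags in closed sets\<close>

lemma poly_fun_tendsto:
  assumes "F \<in> poly_fun" "\<And>i J. ((\<lambda>t. q t i J) \<longlongrightarrow> q0 i J) net"
  shows "((\<lambda>t. F (q t)) \<longlongrightarrow> F q0) net"
  using assms by (induction) (auto intro: tendsto_intros)

lemma plucker_vec_tendsto:
  assumes "\<And>b x. b < k \<Longrightarrow> ((\<lambda>t. (vs t ! b) x) \<longlongrightarrow> (vs0 ! b) x) net"
  shows "((\<lambda>t. plucker_vec k m (vs t) J) \<longlongrightarrow> plucker_vec k m vs0 J) net"
proof (cases "J \<subseteq> {1..m} \<and> card J = k")
  case True
  let ?r = "sorted_list_of_set J"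
  have eq: "plucker_vec k m us J = (\<Sum>p\<in>{p. p permutes {0..<k}}. signof p * (\<Prod>i = 0..<k. (us ! p i) (?r ! i)))" for us
    unfolding plucker_vec_def using True
    by (subst det_def'[of _ k]) (auto intro!: sum.cong prod.cong simp: permutes_in_image[of _ "{0..<k}", simplified])
  show ?thesis unfolding eq
    using assms permutes_in_image[of _ "{0..<k}"] by (intro tendsto_intros) auto
next
  case False
  then show ?thesis unfolding plucker_vec_def by (simp only: if_False tendsto_const)
qed

text \<open>Zariski closed sets are closed under limits of flags with continuously moving generators, as
  long as the dimensions stay constant.  The generators are bases for all \<open>t\<close>, also for \<open>t = 0\<close>,
  so their minors are homogeneous coordinates that depend continuously on \<open>t\<close>.\<close>

lemma closed_limit_of_flags:
  fixes w :: "complex \<Rightarrow> nat \<Rightarrow> cvec"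
  assumes Z: "zariski_closed (odd_flag_ambient n) Z"
    and card: "\<And>i. i \<in> {1..n} \<Longrightarrow> card {j \<in> {1..2 * n}. a j \<le> i} = 2 * i - 1"
    and cont: "\<And>j x. ((\<lambda>t. w t j x) \<longlongrightarrow> w 0 j x) (at 0)"
    and in_Z: "\<And>t. t \<noteq> 0 \<Longrightarrow> flag_of n (w t) a \<in> Z"
    and pts: "flag_of n (w 0) a \<in> points (odd_flag_ambient n)"
  shows "flag_of n (w 0) a \<in> Z"
proof -
  let ?G = "odd_flag_ambient n"
  obtain \<F> where F: "\<F> \<subseteq> (\<Union>D. multihom n D)"
    and Zeq: "Z = {x \<in> points ?G. \<forall>F\<in>\<F>. \<forall>p\<in>hom_coords ?G x. F p = 0}"
    using Z by (auto simp: zariski_closed_def)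
  define js where "js i = sorted_list_of_set {j \<in> {1..2 * n}. a j \<le> i}" for i
  define bs where "bs i t = map (w t) (js i)" for i t
  have pts_t: "flag_of n (w t) a \<in> points ?G" for t
    using pts in_Z Zeq by (cases "t = 0") auto
  have bs: "list_basis (bs i t) (flag_of n (w t) a i)" "length (bs i t) = 2 * i - 1" if i: "i \<in> {1..n}" for i t
  proof -
    show len: "length (bs i t) = 2 * i - 1" using card[OF i] by (simp add: bs_def js_def)
    have "flag_of n (w t) a i \<in> Gr (2 * i - 1) (2 * n)"
      using pts_t[of t] i by (auto simp: points_def)
    then have "cvec.dim (flag_of n (w t) a i) = length (bs i t)" using len by (simp add: Gr_def)
    moreover have "cvec.span (set (bs i t)) = flag_of n (w t) a i"
      using i by (simp add: flag_of_def bs_def js_def)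
    ultimately show "list_basis (bs i t) (flag_of n (w t) a i)" by (intro list_basis_if_spanning)
  qed
  have sub: "flag_of n (w t) a i \<subseteq> coord_space (2 * n)" if "i \<in> {1..n}" for i t
    using points_subset_coord_space[OF pts_t] that by auto
  have "F p = 0" if FF: "F \<in> \<F>" and p: "p \<in> hom_coords ?G (flag_of n (w 0) a)" for F p
  proof -
    have "\<exists>c. c \<noteq> 0 \<and> p i = (\<lambda>J. c * plucker_vec (2 * i - 1) (2 * n) (bs i 0) J)" if i: "i \<in> {1..n}" for i
    proof -
      obtain vs where vs: "p i = plucker_vec (2 * i - 1) (2 * n) vs" "length vs = 2 * i - 1"
          "list_basis vs (flag_of n (w 0) a i)"
        using hom_coords_basis[OF p, of i] i by auto
      have "length (bs i 0) = length vs" using vs(2) bs(2)[OF i] by simp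
      then obtain c where "c \<noteq> 0" "\<And>r. row_minor vs r = c * row_minor (bs i 0) r"
        by (rule row_minor_change_basis[OF bs(1)[OF i] vs(3) sub[OF i]]) (rule that)
      then show ?thesis
        using vs(1,2) bs(2)[OF i] by (intro exI[of _ c]) (auto simp: plucker_vec_eq fun_eq_iff)
    qed
    then obtain c where c: "\<And>i. i \<in> {1..n} \<Longrightarrow> c i \<noteq> 0"
      "\<And>i. i \<in> {1..n} \<Longrightarrow> p i = (\<lambda>J. c i * plucker_vec (2 * i - 1) (2 * n) (bs i 0) J)" by metis
    \<comment> \<open>Scaling by \<open>c\<close> makes the curve start at the given coordinates \<open>p\<close>.\<close>
    define q where "q t i = (if i \<in> {1..n} then (\<lambda>J. c i * plucker_vec (2 * i - 1) (2 * n) (bs i t) J) else (\<lambda>_. 0))" for t i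
    have "q 0 i = p i" for i
      using c(2) p by (cases "i \<in> {1..n}") (auto simp: q_def hom_coords_def)
    then have q0: "q 0 = p" by auto
    have "q t \<in> hom_coords ?G (flag_of n (w t) a)" for t
    proof -
      have "(\<lambda>J. c i * plucker_vec (2 * i - 1) (2 * n) (bs i t) J) \<in> plucker (2 * i - 1) (2 * n) (flag_of n (w t) a i)"
        if i: "i \<in> {1..n}" for i
        by (rule plucker_scale) (use bs[OF i] sub[OF i] c(1)[OF i] i in \<open>auto simp: plucker_eq\<close>)
      then show ?thesis by (auto simp: hom_coords_def q_def)
    qed
    then have zero: "F (q t) = 0" if "t \<noteq> 0" for t
      using in_Z[OF that] FF unfolding Zeq by blast
    have "F \<in> poly_fun" using F FF by (auto simp: multihom_def)
    then have "((\<lambda>t. F (q t)) \<longlongrightarrow> F (q 0)) (at 0)"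
    proof (rule poly_fun_tendsto)
      fix i J
      have "((\<lambda>t. plucker_vec (2 * i - 1) (2 * n) (bs i t) J) \<longlongrightarrow>
          plucker_vec (2 * i - 1) (2 * n) (bs i 0) J) (at 0)" if i: "i \<in> {1..n}"
        by (rule plucker_vec_tendsto) (use cont bs(2)[OF i] in \<open>auto simp: bs_def\<close>)
      then show "((\<lambda>t. q t i J) \<longlongrightarrow> q 0 i J) (at 0)"
        by (auto simp: q_def intro!: tendsto_intros)
    qed
    moreover have "((\<lambda>t. F (q t)) \<longlongrightarrow> 0) (at 0)"
      by (rule tendsto_eventually) (auto simp: zero eventually_at_filter)
    ultimately show "F p = 0" using q0 tendsto_unique[OF at_neq_bot] by metis
  qed
  then show ?thesis unfolding Zeq using pts by blast
qed

section \<open>Exchanging two jumps\<close>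

text \<open>Let \<open>x\<close> jump before \<open>y\<close>.  Between the two jumps the flag contains \<open>w x + t w y\<close>, up to scaling
  \<open>w y + (1/t) w x\<close>, and from the jump of \<open>y\<close> on it contains both \<open>w x\<close> and \<open>w y\<close>.  If \<open>x < y\<close>,
  the new basis is again triangular: on this line of flags only \<open>t = 0\<close> has the jump function
  \<open>a\<close>, and the other flags have the two jumps exchanged.\<close>

lemma flag_of_transpose:
  fixes t :: complex
  assumes xy: "x \<in> {1..2 * n}" "y \<in> {1..2 * n}" "x \<noteq> y" "a x < a y" and t: "t \<noteq> 0"
  shows "flag_of n (w(x := (\<lambda>k. w x k + t * w y k))) a =
    flag_of n (w(y := (\<lambda>k. w y k + (1 / t) * w x k))) (a \<circ> transpose x y)"
proof -
  let ?f = "w(x := (\<lambda>k. w x k + t * w y k))" and ?g = "w(y := (\<lambda>k. w y k + (1 / t) * w x k))"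
  let ?b = "a \<circ> transpose x y"
  have "cvec.span (?f ` {j \<in> {1..2 * n}. a j \<le> i}) = cvec.span (?g ` {j \<in> {1..2 * n}. ?b j \<le> i})"
    (is "cvec.span (?f ` ?J) = cvec.span (?g ` ?K)") for i
  proof
    have gK: "(\<lambda>k. c * ?g j k) \<in> cvec.span (?g ` ?K)" if "j \<in> ?K" for j c
      using that by (intro cvec.span_scale cvec.span_base) auto
    have fJ: "(\<lambda>k. c * ?f j k) \<in> cvec.span (?f ` ?J)" if "j \<in> ?J" for j c
      using that by (intro cvec.span_scale cvec.span_base) auto
    have bx: "?b x = a y" and by': "?b y = a x" and bo: "?b j = a j" if "j \<noteq> x" "j \<noteq> y" for j
      using that by simp_all
    show "cvec.span (?f ` ?J) \<subseteq> cvec.span (?g ` ?K)"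
    proof (intro cvec.span_minimal cvec.subspace_span image_subsetI)
      fix j assume j: "j \<in> ?J"
      consider "j = x" | "j = y" | "j \<noteq> x" "j \<noteq> y" by blast
      then show "?f j \<in> cvec.span (?g ` ?K)"
      proof cases
        case 1
        then have "y \<in> ?K" using j xy by simp
        then have "(\<lambda>k. t * ?g y k) \<in> cvec.span (?g ` ?K)" by (rule gK)
        moreover have "(\<lambda>k. t * ?g y k) = ?f j" using 1 t xy by (auto simp: fun_eq_iff algebra_simps)
        ultimately show ?thesis by (simp only:)
      next
        case 2
        then have "y \<in> ?K" "x \<in> ?K" using j xy by simp_all
        then have "(\<lambda>k. 1 * ?g y k) - (\<lambda>k. (1 / t) * ?g x k) \<in> cvec.span (?g ` ?K)"
          by (intro cvec.span_diff gK)
        moreover have "(\<lambda>k. 1 * ?g y k) - (\<lambda>k. (1 / t) * ?g x k) = ?f j"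
          using 2 xy by (auto simp: fun_eq_iff)
        ultimately show ?thesis by (simp only:)
      next
        case 3
        then have "j \<in> ?K" using j by simp
        then have "?g j \<in> cvec.span (?g ` ?K)" by (intro cvec.span_base) auto
        then show ?thesis using 3 by simp
      qed
    qed
    show "cvec.span (?g ` ?K) \<subseteq> cvec.span (?f ` ?J)"
    proof (intro cvec.span_minimal cvec.subspace_span image_subsetI)
      fix j assume j: "j \<in> ?K"
      consider "j = x" | "j = y" | "j \<noteq> x" "j \<noteq> y" by blast
      then show "?g j \<in> cvec.span (?f ` ?J)"
      proof cases
        case 1
        then have "y \<in> ?J" "x \<in> ?J" using j xy by simp_all
        then have "(\<lambda>k. 1 * ?f x k) - (\<lambda>k. t * ?f y k) \<in> cvec.span (?f ` ?J)"
          by (intro cvec.span_diff fJ)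
        moreover have "(\<lambda>k. 1 * ?f x k) - (\<lambda>k. t * ?f y k) = ?g j"
          using 1 xy by (auto simp: fun_eq_iff)
        ultimately show ?thesis by (simp only:)
      next
        case 2
        then have "x \<in> ?J" using j xy by simp
        then have "(\<lambda>k. (1 / t) * ?f x k) \<in> cvec.span (?f ` ?J)" by (rule fJ)
        moreover have "(\<lambda>k. (1 / t) * ?f x k) = ?g j" using 2 t xy by (auto simp: fun_eq_iff field_simps)
        ultimately show ?thesis by (simp only:)
      next
        case 3
        then have "j \<in> ?J" using j by simp
        then have "?f j \<in> cvec.span (?f ` ?J)" by (intro cvec.span_base) auto
        then show ?thesis using 3 by simp
      qed
    qed
  qed
  then show ?thesis unfolding flag_of_def by (intro restrict_ext)
qed

lemma admissible_jump_count:
  assumes a: "admissible n a" and c: "1 \<le> c" "c \<le> n" "c \<le> d"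
  shows "card {j \<in> {1..2 * n}. c < a j \<and> a j \<le> d} = card {j \<in> {1..2 * n}. a j \<le> d} - (2 * c - 1)"
proof -
  have "{j \<in> {1..2 * n}. c < a j \<and> a j \<le> d} = {j \<in> {1..2 * n}. a j \<le> d} - {j \<in> {1..2 * n}. a j \<le> c}"
    by auto
  moreover have "{j \<in> {1..2 * n}. a j \<le> c} \<subseteq> {j \<in> {1..2 * n}. a j \<le> d}" using c by auto
  moreover have "card {j \<in> {1..2 * n}. a j \<le> c} = 2 * c - 1" using a c by (simp add: admissible_def)
  ultimately show ?thesis by (simp add: card_Diff_subset)
qed

text \<open>If the first \<open>n\<close> vectors jump as late as they may, then the dimensions force the others to jump
  as early as they may.\<close>

lemma admissible_early_jump:
  assumes a: "admissible n a" and ne: "\<exists>j\<in>{1..2 * n}. a j \<noteq> open_jumps n j"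
  shows "\<exists>x\<in>{1..n}. a x \<le> x"
proof (rule ccontr)
  assume "\<not> ?thesis"
  then have low: "a x = x + 1" if "x \<in> {1..n}" for x
  proof -
    have "a x \<le> x + 1" using a that by (auto simp: admissible_def)
    moreover have "\<not> a x \<le> x" using \<open>\<not> (\<exists>x\<in>{1..n}. a x \<le> x)\<close> that by blast
    ultimately show ?thesis by simp
  qed
  have key: "a (n + i) \<le> i" if i: "i \<in> {1..n}" for i
  proof -
    let ?H = "{j \<in> {n + 1..2 * n}. a j \<le> i}"
    have "{j \<in> {1..2 * n}. a j \<le> i} = {1..i - 1} \<union> ?H"
    proof (intro equalityI subsetI)
      fix j assume "j \<in> {j \<in> {1..2 * n}. a j \<le> i}"
      then show "j \<in> {1..i - 1} \<union> ?H" using low[of j] by (cases "j \<le> n") auto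
    next
      fix j assume "j \<in> {1..i - 1} \<union> ?H"
      then show "j \<in> {j \<in> {1..2 * n}. a j \<le> i}" using low[of j] i by auto
    qed
    moreover have "card ({1..i - 1} \<union> ?H) = (i - 1) + card ?H"
      using i by (subst card_Un_disjoint) auto
    moreover have "card {j \<in> {1..2 * n}. a j \<le> i} = 2 * i - 1"
      using a i by (simp add: admissible_def)
    ultimately have "2 * i - 1 = (i - 1) + card ?H" by presburger
    then have "card ?H = card {n + 1..n + i}" using i by auto
    moreover have "?H \<subseteq> {n + 1..n + i}"
      using a by (force simp: admissible_def)
    ultimately have "?H = {n + 1..n + i}" by (intro card_subset_eq) auto
    moreover have "n + i \<in> {n + 1..n + i}" using i by simp
    ultimately have "n + i \<in> ?H" by (simp only:)
    then show ?thesis by simp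
  qed
  then have high: "a j \<le> j - n" if "j \<in> {n + 1..2 * n}" for j
  proof -
    have "n + (j - n) = j" "j - n \<in> {1..n}" using that by auto
    then show ?thesis using key[of "j - n"] by simp
  qed
  obtain j where j: "j \<in> {1..2 * n}" "a j \<noteq> open_jumps n j" using ne by blast
  show False
  proof (cases "j \<le> n")
    case True
    then show False using low[of j] j by (auto simp: open_jumps_def)
  next
    case False
    then have "a j \<le> j - n" "j \<le> n + a j" using high[of j] j a by (auto simp: admissible_def)
    then show False using j False by (auto simp: open_jumps_def)
  qed
qed

text \<open>Counting, with \<open>c = a x\<close>: the dimensions give \<open>2 (x + 1 - c)\<close> indices with a jump in
  \<open>{c<..x + 1}\<close>, or one less if \<open>x = n\<close>.  An index that cannot be exchanged with \<open>x\<close> is either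
  below \<open>x\<close>, hence in \<open>{c..x - 1}\<close>, or of the form \<open>n + v\<close> with \<open>c < v \<le> x + 1\<close> and \<open>v \<le> n\<close>.  This
  is one index too few.\<close>

lemma admissible_exchange:
  assumes a: "admissible n a" and ne: "\<exists>j\<in>{1..2 * n}. a j \<noteq> open_jumps n j"
  obtains x y where "x \<in> {1..n}" "y \<in> {1..2 * n}" "x < y" "a x < a y" "a y \<le> x + 1" "n < y \<Longrightarrow> y \<le> n + a x"
proof -
  obtain x where x: "x \<in> {1..n}" "a x \<le> x" using admissible_early_jump[OF a ne] by blast
  let ?c = "a x"
  let ?S = "{j \<in> {1..2 * n}. ?c < a j \<and> a j \<le> x + 1}"
  have c: "1 \<le> ?c" "?c \<le> n" using a x by (auto simp: admissible_def)
  have "\<exists>y\<in>?S. x < y \<and> (n < y \<longrightarrow> y \<le> n + ?c)"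
  proof (rule ccontr)
    assume none: "\<not> ?thesis"
    have sub: "?S \<subseteq> {?c..x - 1} \<union> {n + ?c + 1..min (n + x + 1) (2 * n)}"
    proof
      fix z assume z: "z \<in> ?S"
      have "z \<noteq> x" using z by auto
      show "z \<in> {?c..x - 1} \<union> {n + ?c + 1..min (n + x + 1) (2 * n)}"
      proof (cases "z < x")
        case True
        then have "a z \<le> z + 1" using a x z by (auto simp: admissible_def)
        then show ?thesis using z True by auto
      next
        case False
        then have "x < z" using \<open>z \<noteq> x\<close> by simp
        then have "\<not> (n < z \<longrightarrow> z \<le> n + ?c)" using none z by blast
        then have "n < z" "n + ?c < z" by auto
        moreover from this have "z \<le> n + a z" using a z by (auto simp: admissible_def)
        ultimately show ?thesis using z by auto
      qed
    qed
    have "card ?S \<le> card ({?c..x - 1} \<union> {n + ?c + 1..min (n + x + 1) (2 * n)})"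
      by (intro card_mono sub) auto
    also have "\<dots> \<le> (x - ?c) + (min (n + x + 1) (2 * n) - (n + ?c))"
      using x by (intro order.trans[OF card_Un_le]) auto
    finally have le: "card ?S \<le> (x - ?c) + (min (n + x + 1) (2 * n) - (n + ?c))" .
    have S: "card ?S = card {j \<in> {1..2 * n}. a j \<le> x + 1} - (2 * ?c - 1)"
      using admissible_jump_count[OF a c, of "x + 1"] x by simp
    show False
    proof (cases "x = n")
      case True
      have "{j \<in> {1..2 * n}. a j \<le> x + 1} = {1..2 * n}"
        using a True by (auto simp: admissible_def)
      then show False using le S True c by auto
    next
      case False
      then have "card {j \<in> {1..2 * n}. a j \<le> x + 1} = 2 * (x + 1) - 1"
        using a x by (simp add: admissible_def)
      then show False using le S x c False by auto
    qed
  qed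
  then show thesis using that x by auto
qed

lemma admissible_transpose:
  assumes a: "admissible n a"
    and xy: "x \<in> {1..n}" "y \<in> {1..2 * n}" "x < y" "a x < a y" "a y \<le> x + 1" "n < y \<Longrightarrow> y \<le> n + a x"
  shows "admissible n (a \<circ> transpose x y)"
proof -
  let ?b = "a \<circ> transpose x y"
  have tr: "transpose x y ` {1..2 * n} = {1..2 * n}"
    using xy by (intro permutes_image permutes_swap_id) auto
  have "card {j \<in> {1..2 * n}. ?b j \<le> i} = card {j \<in> {1..2 * n}. a j \<le> i}" for i
  proof -
    have "{j \<in> {1..2 * n}. a j \<le> i} = transpose x y ` {j \<in> {1..2 * n}. ?b j \<le> i}"
    proof (intro equalityI subsetI)
      fix j assume j: "j \<in> {j \<in> {1..2 * n}. a j \<le> i}"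
      then have "transpose x y j \<in> {1..2 * n}" using tr by blast
      then show "j \<in> transpose x y ` {j \<in> {1..2 * n}. ?b j \<le> i}"
        using j by (intro image_eqI[of _ _ "transpose x y j"]) auto
    next
      fix j assume "j \<in> transpose x y ` {j \<in> {1..2 * n}. ?b j \<le> i}"
      then show "j \<in> {j \<in> {1..2 * n}. a j \<le> i}" using tr by force
    qed
    then show ?thesis by (simp add: card_image)
  qed
  then have "card {j \<in> {1..2 * n}. ?b j \<le> i} = 2 * i - 1" if "i \<in> {1..n}" for i
    using a that by (simp add: admissible_def)
  moreover have "1 \<le> ?b j \<and> ?b j \<le> n + 1" if "j \<in> {1..2 * n}" for j
  proof -
    have "transpose x y j \<in> {1..2 * n}" using tr that by blast
    then show ?thesis using a by (simp add: admissible_def)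
  qed
  moreover have "?b j \<le> j + 1" if j: "j \<in> {1..n}" for j
  proof -
    have ax: "a x \<le> x + 1" "a j \<le> j + 1" using a j xy by (auto simp: admissible_def)
    show ?thesis using ax xy by (cases "j = x"; cases "j = y") auto
  qed
  moreover have "j \<le> n + ?b j" if j: "j \<in> {n + 1..2 * n}" for j
  proof -
    have "j \<le> n + a j" "j \<noteq> x" using a j xy by (auto simp: admissible_def)
    then show ?thesis using j xy by (cases "j = y") auto
  qed
  ultimately show ?thesis unfolding admissible_def by blast
qed

lemma weight_transpose_less:
  fixes a :: "nat \<Rightarrow> nat"
  assumes xy: "x \<in> A" "y \<in> A" "x < y" "a x < a y" and A: "finite A"
  shows "(\<Sum>j\<in>A. j * (a \<circ> transpose x y) j) < (\<Sum>j\<in>A. j * a j)"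
proof -
  have split: "(\<Sum>j\<in>A. f j) = f x + f y + (\<Sum>j\<in>A - {x} - {y}. f j)" for f :: "nat \<Rightarrow> nat"
    using sum.remove[OF A xy(1), of f] sum.remove[of "A - {x}" y f] A xy by auto
  have rest: "(\<Sum>j\<in>A - {x} - {y}. j * (a \<circ> transpose x y) j) = (\<Sum>j\<in>A - {x} - {y}. j * a j)"
    by (intro sum.cong) auto
  obtain d e where "y = x + d" "0 < d" "a y = a x + e" "0 < e"
    using xy less_imp_add_positive by metis
  then have "x * a y + y * a x < x * a x + y * a y" by (simp add: algebra_simps)
  then show ?thesis unfolding split[of "\<lambda>j. j * (a \<circ> transpose x y) j"] split[of "\<lambda>j. j * a j"] rest by simp
qed

section \<open>Density of the orbit\<close>

text \<open>Induction on \<open>\<Sum>j. j * a j\<close>, which decreases when an earlier jump is moved to a larger index.  The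
  only jump function without a possible exchange is that of the orbit itself.\<close>

lemma orbit_dense_in_squeezed_flag:
  assumes Z: "zariski_closed (odd_flag_ambient n) Z"
    and orbit: "(\<lambda>A. flag_act n A (coord_flag n (sigma n))) ` borel_group n \<subseteq> Z"
    and w: "triangular (2 * n) w" "\<And>j. j \<in> {1..2 * n} \<Longrightarrow> w j j = 1" and a: "admissible n a"
  shows "flag_of n w a \<in> Z"
  using w a
proof (induction "\<Sum>j\<in>{1..2 * n}. j * a j" arbitrary: a w rule: less_induct)
  case less
  note w = less.prems(1,2) and a = less.prems(3)
  show ?case
  proof (cases "\<exists>j\<in>{1..2 * n}. a j \<noteq> open_jumps n j")
    case False
    then have "flag_of n w a = flag_of n w (open_jumps n)"
      unfolding flag_of_def by (intro restrict_ext arg_cong[where f = cvec.span] arg_cong2[where f = image]) auto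
    then show ?thesis using flag_of_open_jumps_in_orbit[OF w] orbit by auto
  next
    case True
    obtain x y where xy: "x \<in> {1..n}" "y \<in> {1..2 * n}" "x < y" "a x < a y" "a y \<le> x + 1"
      "n < y \<Longrightarrow> y \<le> n + a x"
      by (rule admissible_exchange[OF a True]) (rule that)
    have x: "x \<in> {1..2 * n}" using xy by auto
    \<comment> \<open>For \<open>t \<noteq> 0\<close> the flag of \<open>wt t\<close> and \<open>a\<close> has the jumps of \<open>x\<close> and \<open>y\<close> exchanged, so it is in \<open>Z\<close> by induction.\<close>
    define wt where "wt t = w(x := (\<lambda>k. w x k + t * w y k))" for t
    have "flag_of n (wt 0) a \<in> Z"
    proof (rule closed_limit_of_flags[OF Z])
      show "card {j \<in> {1..2 * n}. a j \<le> i} = 2 * i - 1" if "i \<in> {1..n}" for i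
        using a that by (simp add: admissible_def)
      show "((\<lambda>t. wt t j k) \<longlongrightarrow> wt 0 j k) (at 0)" for j k
        unfolding wt_def by (cases "j = x") (auto intro!: tendsto_eq_intros)
      show "flag_of n (wt 0) a \<in> points (odd_flag_ambient n)"
        using flag_of_in_squeezed_flag[OF w(1) a]
        by (simp add: wt_def squeezed_flag_def odd_flag_def)
      fix t :: complex assume t: "t \<noteq> 0"
      let ?g = "w(y := (\<lambda>k. w y k + (1 / t) * w x k))"
      have "w x \<in> coord_space x" using w(1) x by (auto simp: triangular_def)
      then have wx: "w x k = 0" if "k \<ge> y" for k using that xy by (auto simp: coord_space_def)
      have "flag_of n ?g (a \<circ> transpose x y) \<in> Z"
      proof (rule less.hyps)
        show "(\<Sum>j\<in>{1..2 * n}. j * (a \<circ> transpose x y) j) < (\<Sum>j\<in>{1..2 * n}. j * a j)"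
          using x xy by (intro weight_transpose_less) auto
        show "admissible n (a \<circ> transpose x y)"
          by (rule admissible_transpose[OF a xy(1-5)]) (use xy in auto)
        show "triangular (2 * n) ?g"
          using w(1) xy wx by (auto simp: triangular_def coord_space_def)
        show "?g j j = 1" if "j \<in> {1..2 * n}" for j using w(2)[OF that] wx by auto
      qed
      then show "flag_of n (wt t) a \<in> Z"
        using flag_of_transpose[of x n y a t w] x xy t by (simp add: wt_def)
    qed
    then show ?thesis by (simp add: wt_def)
  qed
qed

text \<open>One inclusion holds because the squeezed flags form a closed set that contains the orbit, the other
  one is the density of the orbit.\<close>

lemma schubert_eq_squeezed_flag: "schubert n (sigma n) = squeezed_flag n"
proof
  have "(\<lambda>A. flag_act n A (coord_flag n (sigma n))) ` borel_group n \<subseteq> squeezed_flag n"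
    using orbit_in_squeezed_flag by blast
  then show "schubert n (sigma n) \<subseteq> squeezed_flag n"
    using zariski_closed_squeezed_flag unfolding schubert_def by blast
  show "squeezed_flag n \<subseteq> schubert n (sigma n)"
  proof
    fix W assume W: "W \<in> squeezed_flag n"
    obtain w a where wa: "triangular (2 * n) w" "\<And>j. j \<in> {1..2 * n} \<Longrightarrow> w j j = 1" "admissible n a"
      "W = flag_of n w a"
      by (rule flag_of_exists[OF W]) (rule that)
    have "W \<in> odd_flag n" using W by (simp add: squeezed_flag_def)
    then show "W \<in> schubert n (sigma n)"
      unfolding schubert_def using orbit_dense_in_squeezed_flag[OF _ _ wa(1,2,3)] wa(4) by blast
  qed
qed

section \<open>Equivariance\<close>

lemma mat_apply_torus:
  assumes "A \<in> torus n"
  shows "mat_apply A w = (\<lambda>k. if k \<in> {1..2 * n} then A $$ (k - 1, k - 1) * w k else 0)"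
proof
  fix k
  have A: "A \<in> carrier_mat (2 * n) (2 * n)" "diagonal_mat A"
    using assms by (auto simp: torus_def borel_group_def)
  have "(\<Sum>j\<in>{1..2 * n}. A $$ (k - 1, j - 1) * w j) = A $$ (k - 1, k - 1) * w k" if k: "k \<in> {1..2 * n}"
  proof -
    have "A $$ (k - 1, j - 1) = 0" if "j \<in> {1..2 * n}" "j \<noteq> k" for j
    proof -
      have "k - 1 < 2 * n" "j - 1 < 2 * n" "k - 1 \<noteq> j - 1" using k that by auto
      then show ?thesis using A by (auto simp: diagonal_mat_def)
    qed
    then have "(\<Sum>j\<in>{1..2 * n}. A $$ (k - 1, j - 1) * w j) = (\<Sum>j\<in>{k}. A $$ (k - 1, j - 1) * w j)"
      using k by (intro sum.mono_neutral_right) auto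
    then show ?thesis by simp
  qed
  then show "mat_apply A w k = (if k \<in> {1..2 * n} then A $$ (k - 1, k - 1) * w k else 0)"
    using A(1) by (simp add: mat_apply_def)
qed

lemma torus_diag_nonzero:
  assumes "A \<in> torus n" "k \<in> {1..2 * n}"
  shows "A $$ (k - 1, k - 1) \<noteq> 0"
proof -
  have A: "A \<in> carrier_mat (2 * n) (2 * n)" "upper_triangular A" "det A = 1"
    using assms(1) by (auto simp: torus_def borel_group_def)
  then have "0 \<notin> set (diag_mat A)"
    using det_upper_triangular[OF A(2,1)] by (metis prod_list_zero_iff zero_neq_one)
  moreover have "k - 1 < 2 * n" using assms(2) by auto
  ultimately show ?thesis using A(1) by (force simp: diag_mat_def)
qed

lemma to_window_mat_apply:
  assumes A: "A \<in> torus n" and i: "1 \<le> i" "i \<le> n"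
  shows "to_window n i (mat_apply A w) = window_act n A i (to_window n i w)"
proof
  fix k
  show "to_window n i (mat_apply A w) k = window_act n A i (to_window n i w) k"
  proof (cases "k \<in> {1..n + 1}")
    case True
    then show ?thesis using pos_range[OF i True] i
      by (auto simp: to_window_def window_act_def mat_apply_torus[OF A] pos_def)
  qed (auto simp: to_window_def window_act_def)
qed

lemma window_act_inject:
  assumes A: "A \<in> torus n" and i: "1 \<le> i" "i \<le> n"
    and v: "v \<in> coord_space (n + 1)" "v' \<in> coord_space (n + 1)"
    and eq: "window_act n A i v = window_act n A i v'"
  shows "v = v'"
proof
  fix k
  show "v k = v' k"
  proof (cases "k \<in> {1..n + 1}")
    case True
    have "window_act n A i v k = window_act n A i v' k" using eq by simp
    then show ?thesis
      using torus_diag_nonzero[OF A, of k] torus_diag_nonzero[OF A, of "n + 1 + k"] True i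
      by (cases "i \<le> k") (auto simp: window_act_def split: if_splits)
  next
    case False
    then show ?thesis using v by (simp add: coord_space_def)
  qed
qed

text \<open>The weights of the action on the \<open>i\<close>-th factor are those of \<open>W\<close> in the window at \<open>i\<close>.\<close>

lemma zeta_equivariant:
  assumes A: "A \<in> torus n" and V: "V \<in> deg_flag n"
  shows "zeta n (deg_flag_act n A V) = flag_act n A (zeta n V)"
proof
  fix i
  show "zeta n (deg_flag_act n A V) i = flag_act n A (zeta n V) i"
  proof (cases "i \<in> {1..n}")
    case True
    then have i: "1 \<le> i" "i \<le> n" by auto
    have "zeta_space n i (window_act n A i ` V i) = mat_apply A ` zeta_space n i (V i)"
    proof (intro equalityI subsetI)
      fix w assume "w \<in> mat_apply A ` zeta_space n i (V i)"
      then obtain u where u: "u \<in> coord_space (n + i)" "to_window n i u \<in> V i" "w = mat_apply A u"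
        by (auto simp: zeta_space_def)
      then have "w \<in> coord_space (n + i)"
        by (auto simp: mat_apply_torus[OF A] coord_space_def)
      then show "w \<in> zeta_space n i (window_act n A i ` V i)"
        using u to_window_mat_apply[OF A i] by (auto simp: zeta_space_def)
    next
      fix w assume "w \<in> zeta_space n i (window_act n A i ` V i)"
      then obtain v where w: "w \<in> coord_space (n + i)" "v \<in> V i" "to_window n i w = window_act n A i v"
        by (auto simp: zeta_space_def)
      define u where "u k = w k / A $$ (k - 1, k - 1)" for k
      have Au: "mat_apply A u = w"
      proof
        fix k show "mat_apply A u k = w k"
          using torus_diag_nonzero[OF A, of k] w(1) i
          by (auto simp: mat_apply_torus[OF A] u_def coord_space_def)
      qed
      have "v \<in> coord_space (n + 1)"
        using points_subset_coord_space[of V "deg_flag_ambient n" i] V True w(2)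
        by (auto simp: deg_flag_def)
      moreover have "window_act n A i (to_window n i u) = window_act n A i v"
        using to_window_mat_apply[OF A i, of u] Au w(3) by simp
      ultimately have "to_window n i u = v"
        by (intro window_act_inject[OF A i to_window_in_coord_space])
      then have "u \<in> zeta_space n i (V i)"
        using w(1,2) by (simp add: zeta_space_def coord_space_def u_def)
      then show "w \<in> mat_apply A ` zeta_space n i (V i)" using Au by blast
    qed
    then show ?thesis using True by (simp add: zeta_def deg_flag_act_def flag_act_def)
  qed (auto simp: zeta_def flag_act_def)
qed

theorem theorem1p2:
  fixes n :: nat
  assumes "n \<ge> 1"
  shows "\<exists>\<zeta>. projective_variety_iso
            (deg_flag_ambient n) (deg_flag n)
            (odd_flag_ambient n) (schubert n (sigma n)) \<zeta> \<and>
          (\<forall>A\<in>torus n. \<forall>V\<in>deg_flag n. \<zeta> (deg_flag_act n A V) = flag_act n A (\<zeta> V))"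
  using zeta_iso zeta_equivariant unfolding schubert_eq_squeezed_flag by blast

end
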